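(* Let $k$ be a field, let $\Delta$ be a simplicial complex on the vertex set $[n]$, and let $k[\Delta]$ be its Stanley-Reisner ring with its standard $\mathbb{Z}$-grading (every $x_i$ has degree $1$). If $R$ is a $\mathbb{Z}$-graded algebra retract of $k[\Delta]$, then $R$ is a Stanley-Reisner ring over $k$, i.e. $R$ is isomorphic as a $k$-algebra to $k[\Delta']$ for some simplicial complex $\Delta'$.
   Context: All rings are Noetherian, commutative with unit, and nonzero. A simplicial complex $\Delta$ on $[n]=\{1,\dots,n\}$ is a nonempty set of subsets of $[n]$ such that $\{i\}\in\Delta$ for all $i\in[n]$ and every subset of an element of $\Delta$ is in $\Delta$; the case $n=0$, $\Delta=\{\emptyset\}$ is allowed. Its Stanley-Reisner ring over $k$ is $k[\Delta]=k[x_1,\dots,x_n]/I_\Delta$, where $I_\Delta$ is the ideal generated by all monomials $x^a$, $a\in\mathbb{N}^n$, with $\operatorname{supp}(a)=\{j: a_j\neq 0\}\notin\Delta$. For $n=0$ one has $k[\Delta]=k$. A graded algebra retract of a graded $k$-algebra $B$ is a graded $k$-algebra $R$ together with degree-preserving $k$-algebra homomorphisms $\theta:R\to B$ (injective) and $\phi:B\to R$ (the retraction map) such that $\phi\circ\theta=\mathrm{id}_R$. *)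

theory Defs
  imports
    "HOL-Algebra.Module"
    "HOL-Algebra.Ring_Divisibility"
    "HOL-Library.Poly_Mapping"
    "HOL-Decision_Procs.Algebra_Aux"
begin

section \<open>Algebras, gradings and graded retracts\<close>

definition algebra_hom ::
    "('k, 'm) ring_scheme \<Rightarrow> ('k, 'a) module \<Rightarrow> ('k, 'b) module \<Rightarrow> ('a \<Rightarrow> 'b) set" where
  "algebra_hom K A B =
     {h \<in> ring_hom A B. \<forall>c \<in> carrier K. \<forall>x \<in> carrier A. h (c \<odot>\<^bsub>A\<^esub> x) = c \<odot>\<^bsub>B\<^esub> h x}"

definition algebra_isomorphic ::
    "('k, 'm) ring_scheme \<Rightarrow> ('k, 'a) module \<Rightarrow> ('k, 'b) module \<Rightarrow> bool" where
  "algebra_isomorphic K A B \<longleftrightarrow>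
     (\<exists>h \<in> algebra_hom K A B. bij_betw h (carrier A) (carrier B))"

text \<open>
  \<open>G i\<close> is the component of degree \<open>i\<close>. The last axiom says that the algebra is the
  internal direct sum of its components.
\<close>
locale graded_algebra = algebra K A for K (structure) and A (structure) +
  fixes G :: "int \<Rightarrow> 'c set"
  assumes component_submodule: "submodule (G i) K A"
    and component_mult: "\<lbrakk>x \<in> G i; y \<in> G j\<rbrakk> \<Longrightarrow> x \<otimes>\<^bsub>A\<^esub> y \<in> G (i + j)"
    and component_decomposition:
      "x \<in> carrier A \<Longrightarrow>
         \<exists>!f. (\<forall>i. f i \<in> G i) \<and> finite {i. f i \<noteq> \<zero>\<^bsub>A\<^esub>} \<and>
              x = finsum A f {i. f i \<noteq> \<zero>\<^bsub>A\<^esub>}"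

definition graded_algebra_retract ::
    "('k, 'm) ring_scheme \<Rightarrow> ('k, 'b) module \<Rightarrow> (int \<Rightarrow> 'b set) \<Rightarrow>
     ('k, 'a) module \<Rightarrow> (int \<Rightarrow> 'a set) \<Rightarrow> bool" where
  "graded_algebra_retract K B H R G \<longleftrightarrow>
     graded_algebra K B H \<and> graded_algebra K R G \<and>
     (\<exists>\<theta> \<phi>. \<theta> \<in> algebra_hom K R B \<and> (\<forall>i. \<theta> ` G i \<subseteq> H i) \<and> inj_on \<theta> (carrier R) \<and>
            \<phi> \<in> algebra_hom K B R \<and> (\<forall>i. \<phi> ` H i \<subseteq> G i) \<and>
            (\<forall>x \<in> carrier R. \<phi> (\<theta> x) = x))"

section \<open>Stanley-Reisner rings\<close>

text \<open>
  A polynomial maps exponent vectors to coefficients, both with finite support. The ground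
  field is the whole type \<open>'k\<close>, turned into a ring record by \<^const>\<open>cring_class_ops\<close>;
  the same constant supplies the ring operations on polynomials.
\<close>
type_synonym 'k mpolynomial = "(nat \<Rightarrow>\<^sub>0 nat) \<Rightarrow>\<^sub>0 'k"

definition simplicial_complex :: "nat \<Rightarrow> nat set set \<Rightarrow> bool" where
  "simplicial_complex n \<Delta> \<longleftrightarrow>
     \<Delta> \<noteq> {} \<and> \<Delta> \<subseteq> Pow {1..n} \<and> (\<forall>i \<in> {1..n}. {i} \<in> \<Delta>) \<and>
     (\<forall>F \<in> \<Delta>. \<forall>F'. F' \<subseteq> F \<longrightarrow> F' \<in> \<Delta>)"

text \<open>The ring \<open>k[x\<^sub>1, \<dots>, x\<^sub>n]\<close>.\<close>
definition poly_ring :: "nat \<Rightarrow> 'k::field mpolynomial ring" where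
  "poly_ring n = cring_class_ops
     \<lparr>carrier := {p. \<forall>a \<in> Poly_Mapping.keys p. Poly_Mapping.keys a \<subseteq> {1..n}}\<rparr>"

definition SR_ideal :: "nat \<Rightarrow> nat set set \<Rightarrow> 'k::field mpolynomial set" where
  "SR_ideal n \<Delta> = Idl\<^bsub>poly_ring n\<^esub>
     {Poly_Mapping.single a 1 | a.
        Poly_Mapping.keys a \<subseteq> {1..n} \<and> Poly_Mapping.keys a \<notin> \<Delta>}"

definition SR_class :: "nat \<Rightarrow> nat set set \<Rightarrow> 'k::field mpolynomial \<Rightarrow> 'k mpolynomial set" where
  "SR_class n \<Delta> p = SR_ideal n \<Delta> +>\<^bsub>poly_ring n\<^esub> p"

text \<open>A scalar acts as multiplication by the class of the constant polynomial.\<close>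
definition SR_ring :: "nat \<Rightarrow> nat set set \<Rightarrow> ('k::field, 'k mpolynomial set) module" where
  "SR_ring n \<Delta> = ring.extend (poly_ring n Quot SR_ideal n \<Delta>)
     (module.fields
       (\<lambda>c Y. SR_class n \<Delta> (Poly_Mapping.single 0 c)
                \<otimes>\<^bsub>poly_ring n Quot SR_ideal n \<Delta>\<^esub> Y))"

definition homogeneous :: "int \<Rightarrow> 'k::field mpolynomial \<Rightarrow> bool" where
  "homogeneous d p \<longleftrightarrow>
     (\<forall>a \<in> Poly_Mapping.keys p. int (\<Sum>j \<in> Poly_Mapping.keys a. Poly_Mapping.lookup a j) = d)"

definition SR_grading :: "nat \<Rightarrow> nat set set \<Rightarrow> int \<Rightarrow> 'k::field mpolynomial set set" where
  "SR_grading n \<Delta> d = SR_class n \<Delta> ` {p \<in> carrier (poly_ring n). homogeneous d p}"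

end

theory Submission
  imports Defs Complex_Main
begin

text \<open>
  The composite \<open>e = \<theta> \<circ> \<phi>\<close> is an idempotent graded endomorphism of \<open>k[\<Delta>]\<close> with image isomorphic to \<open>R\<close>,
  determined by the linear forms \<open>y j = e (x j)\<close>. Call a face \<open>F\<close> stable if \<open>y j\<close> vanishes on the
  coordinate subspace of \<open>F\<close> for all \<open>j \<notin> F\<close>. For every face \<open>F\<close>, the indices \<open>i\<close> for which \<open>y i\<close> does
  not vanish on \<open>F\<close> form a face again, and this face is contained in a stable one. The complements of
  stable faces belong to a lattice of sets \<open>U\<close> for which the spans of \<open>{y j | j \<in> U}\<close> form a
  distributive lattice of subspaces, because \<open>e\<close> is idempotent. Hence some of the \<open>y j\<close>, with
  \<open>j = t 1, \<dots>, t m\<close>, form a basis of the span of all of them that is adapted to every such \<open>U\<close>. In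
  this basis the relations between the \<open>y j\<close> become monomial: \<open>R\<close> is the Stanley-Reisner ring of
  the complex of all \<open>Q \<subseteq> {1..m}\<close> such that \<open>t ` Q\<close> lies in a stable face.
\<close>

section \<open>Bases adapted to a distributive lattice of subspaces\<close>

context vector_space begin

text \<open>Passing from \<open>U\<close> to the span of the \<open>y j\<close> with
  \<open>j\<close> in \<open>U\<close> always turns unions into sums, and by \<open>cap\<close> it
  turns intersections into intersections. The spans thus form a distributive lattice of subspaces,
  which is why a single basis can serve all of them; it is chosen among the \<open>y j\<close>
  themselves.\<close>

lemma distributive_family_basis:
  fixes y :: "'i \<Rightarrow> 'b"
  assumes fin: "finite N"
    and sub: "\<U> \<subseteq> Pow N" and top: "N \<in> \<U>"
    and Int: "\<And>A B. A \<in> \<U> \<Longrightarrow> B \<in> \<U> \<Longrightarrow> A \<inter> B \<in> \<U>"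
    and Un: "\<And>A B. A \<in> \<U> \<Longrightarrow> B \<in> \<U> \<Longrightarrow> A \<union> B \<in> \<U>"
    and cap: "\<And>A B. A \<in> \<U> \<Longrightarrow> B \<in> \<U> \<Longrightarrow> span (y ` A) \<inter> span (y ` B) \<subseteq> span (y ` (A \<inter> B))"
  shows "\<exists>T\<subseteq>N. inj_on y T \<and> independent (y ` T) \<and> (\<forall>U\<in>\<U>. y ` U \<subseteq> span (y ` (T \<inter> U)))"
proof -
  have finU: "finite \<U>" using sub fin by (meson finite_Pow_iff finite_subset)
  \<comment> \<open>Weigh \<open>j\<close> by the size of the least member of \<open>\<U>\<close> containing it and take a spanning subfamily of
    least total weight. If \<open>y j\<close> needed basis vectors outside \<open>S j\<close>, the part of its expansion
    supported there would by \<open>cap\<close> lie in the span of vectors strictly lighter than the heaviest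
    of them, against independence.\<close>
  define S where "S j = \<Inter>{U \<in> \<U>. j \<in> U}" for j
  have S_mem: "S j \<in> \<U>" if "j \<in> N" for j
  proof -
    have "\<Inter>\<V> \<in> \<U>" if "finite \<V>" "\<V> \<noteq> {}" "\<V> \<subseteq> \<U>" for \<V>
      using that by (induction rule: finite_ne_induct) (auto intro: Int)
    from this[of "{U \<in> \<U>. j \<in> U}"] show ?thesis
      using that top finU unfolding S_def by auto
  qed
  have S_self: "j \<in> S j" for j unfolding S_def by auto
  have S_least: "S j \<subseteq> U" if "U \<in> \<U>" "j \<in> U" for j U using that unfolding S_def by auto
  have S_fin: "finite (S j)" if "j \<in> N" for j using S_mem[OF that] sub fin finite_subset by blast
  define w where "w j = card (S j)" for j
  have w_pos: "w j > 0" if "j \<in> N" for j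
    using S_fin[OF that] S_self unfolding w_def by (auto simp: card_gt_0_iff)
  define sp where "sp T \<longleftrightarrow> T \<subseteq> N \<and> y ` N \<subseteq> span (y ` T)" for T
  have "sp N" unfolding sp_def using span_superset by auto
  then obtain T where T: "sp T" and T_min: "\<And>T'. sp T' \<Longrightarrow> sum w T \<le> sum w T'"
    using ex_has_least_nat[of sp N "sum w"] by blast
  have TN: "T \<subseteq> N" and finT: "finite T" using T fin finite_subset unfolding sp_def by auto
  \<comment> \<open>Minimality enters through this exchange: a family in \<open>N\<close> that
    contains \<open>T - {i}\<close> and has \<open>y i\<close> in its span spans at least as much as
    \<open>T\<close>, so it weighs at least as much.\<close>
  have exchange: "sum w T \<le> sum w T'"
    if "i \<in> T" "T - {i} \<subseteq> T'" "T' \<subseteq> N" "y i \<in> span (y ` T')" for i T'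
  proof (rule T_min)
    have "y ` T \<subseteq> span (y ` T')"
      using that span_superset[of "y ` T'"] by blast
    then have "span (y ` T) \<subseteq> span (y ` T')" by (simp add: span_minimal)
    then show "sp T'" using T that unfolding sp_def by blast
  qed
  have indep: "y i \<notin> span (y ` (T - {i}))" if "i \<in> T" for i
  proof
    assume "y i \<in> span (y ` (T - {i}))"
    then have "sum w T \<le> sum w (T - {i})" using exchange[OF that] TN by blast
    then show False using w_pos[of i] TN that finT by (auto simp: sum.remove[of T i])
  qed
  \<comment> \<open>Exchange \<open>i\<close> for \<open>j\<close>. The sum over the new family is
    only bounded above, because \<open>j\<close> may already belong to
    \<open>T - {i}\<close>.\<close>
  have w_mono: "w i \<le> w j" if "i \<in> T" "j \<in> N" "y i \<in> span (insert (y j) (y ` (T - {i})))" for i j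
  proof -
    have "w i + sum w (T - {i}) \<le> sum w (insert j (T - {i}))"
      using exchange[OF that(1), of "insert j (T - {i})"] TN that finT
      by (auto simp: sum.remove[of T i])
    also have "\<dots> \<le> w j + sum w (T - {i})" using finT by (simp add: sum.insert_if)
    finally show ?thesis by simp
  qed
  \<comment> \<open>A smallest subset of \<open>T\<close> whose span contains \<open>y j\<close>: by
    minimality each of its members is needed for \<open>y j\<close> and can therefore be exchanged
    for \<open>j\<close>.\<close>
  have "\<exists>T0\<subseteq>T. y j \<in> span (y ` T0) \<and> (\<forall>i\<in>T0. y j \<notin> span (y ` (T0 - {i})))" if "j \<in> N" for j
  proof -
    define P where "P T' \<longleftrightarrow> T' \<subseteq> T \<and> y j \<in> span (y ` T')" for T'
    have "P T" using T that unfolding sp_def P_def by auto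
    then obtain T0 where "P T0" and least: "\<And>T'. P T' \<Longrightarrow> card T0 \<le> card T'"
      using ex_has_least_nat[of P T card] by metis
    have "y j \<notin> span (y ` (T0 - {i}))" if "i \<in> T0" for i
    proof
      assume "y j \<in> span (y ` (T0 - {i}))"
      then have "card T0 \<le> card (T0 - {i})" using least \<open>P T0\<close> unfolding P_def by blast
      moreover have "finite T0" using \<open>P T0\<close> finT finite_subset unfolding P_def by blast
      ultimately show False using that by (meson card_Diff1_less linorder_not_less)
    qed
    then show ?thesis using \<open>P T0\<close> unfolding P_def by blast
  qed
  then obtain T0 where T0: "\<And>j. j \<in> N \<Longrightarrow> T0 j \<subseteq> T" "\<And>j. j \<in> N \<Longrightarrow> y j \<in> span (y ` T0 j)"
    "\<And>i j. j \<in> N \<Longrightarrow> i \<in> T0 j \<Longrightarrow> y j \<notin> span (y ` (T0 j - {i}))"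
    by metis
  have ex0: "y i \<in> span (insert (y j) (y ` (T0 j - {i})))" if "j \<in> N" "i \<in> T0 j" for i j
    using T0(2,3)[OF that(1)] that(2) in_span_insert[of "y j" "y i" "y ` (T0 j - {i})"]
    by (metis image_insert insert_Diff)
  have ex: "y i \<in> span (insert (y j) (y ` (T - {i})))" if "j \<in> N" "i \<in> T0 j" for i j
  proof -
    have "insert (y j) (y ` (T0 j - {i})) \<subseteq> insert (y j) (y ` (T - {i}))"
      using T0(1)[OF that(1)] by auto
    then show ?thesis using ex0[OF that] span_mono by blast
  qed
  have wle: "w i \<le> w j" if "j \<in> N" "i \<in> T0 j" for i j
    using w_mono[OF _ that(1) ex[OF that]] T0(1) that by blast
  have main: "T0 j \<subseteq> S j" if j: "j \<in> N" for j
  proof (rule ccontr)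
    define Bad where "Bad = T0 j - S j"
    assume "\<not> T0 j \<subseteq> S j"
    then have "Bad \<noteq> {}" by (auto simp: Bad_def)
    have BadT: "Bad \<subseteq> T" using T0(1)[OF j] by (auto simp: Bad_def)
    have "finite Bad" using BadT finT finite_subset by blast
    then have "Max (w ` Bad) \<in> w ` Bad" using \<open>Bad \<noteq> {}\<close> by (intro Max_in) auto
    then obtain i' where i': "i' \<in> Bad" "Max (w ` Bad) = w i'" by blast
    have max: "w i \<le> w i'" if "i \<in> Bad" for i
      using Max_ge[of "w ` Bad" "w i"] that \<open>finite Bad\<close> i'(2) by simp
    define V where "V = \<Union>(S ` Bad)"
    have "\<Union>(S ` X) \<in> \<U>" if "finite X" "X \<noteq> {}" "X \<subseteq> N" for X
      using that by (induction rule: finite_ne_induct) (auto intro: Un S_mem)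
    then have V: "V \<in> \<U>" unfolding V_def using \<open>finite Bad\<close> \<open>Bad \<noteq> {}\<close> BadT TN by blast
    have "y j \<in> span (y ` (T0 j \<inter> S j) \<union> y ` Bad)"
      using T0(2)[OF j] unfolding Bad_def by (metis Int_Diff_Un image_Un)
    then obtain g z where gz: "y j = g + z" "g \<in> span (y ` (T0 j \<inter> S j))" "z \<in> span (y ` Bad)"
      unfolding span_Un by blast
    \<comment> \<open>As a combination over \<open>Bad\<close>, \<open>z\<close> lies in the span
      belonging to \<open>V\<close>; as the difference of \<open>y j\<close> and \<open>g\<close>,
      it lies in the span belonging to \<open>S j\<close>. Then \<open>cap\<close> applies.\<close>
    have "z \<in> span (y ` V)"
      using gz(3) S_self span_mono[of "y ` Bad" "y ` V"] unfolding V_def by blast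
    moreover have "z \<in> span (y ` S j)"
    proof -
      have "g \<in> span (y ` S j)" using gz(2) span_mono[of "y ` (T0 j \<inter> S j)" "y ` S j"] by blast
      moreover have "y j \<in> span (y ` S j)" using S_self by (simp add: span_base)
      moreover have "z = y j - g" using gz(1) by simp
      ultimately show ?thesis using span_diff by blast
    qed
    ultimately have z: "z \<in> span (y ` (S j \<inter> V))"
      using cap[OF S_mem[OF j] V] by blast
    have "y ` (S j \<inter> V) \<subseteq> span (y ` (T - {i'}))"
    proof
      fix v assume "v \<in> y ` (S j \<inter> V)"
      then obtain l i where l: "v = y l" "l \<in> S j" "l \<in> S i" "i \<in> Bad" by (auto simp: V_def)
      have iN: "i \<in> N" using l BadT TN by blast
      have lN: "l \<in> N" using l(2) S_mem[OF j] sub by blast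
      \<comment> \<open>The index \<open>i\<close> lies in \<open>S i\<close> but not in
        \<open>S j\<close>, which contains \<open>S l\<close>. So \<open>S l\<close> is a proper
        subset of \<open>S i\<close>, \<open>l\<close> is lighter than \<open>i'\<close>, and by
        \<open>wle\<close> the set \<open>T0 l\<close> omits \<open>i'\<close>.\<close>
      have "S l \<subseteq> S i" using S_least[OF S_mem[OF iN] l(3)] .
      moreover have "i \<notin> S l" using S_least[OF S_mem[OF j] l(2)] l(4) by (auto simp: Bad_def)
      ultimately have "S l \<subset> S i" using S_self by blast
      then have "w l < w i" unfolding w_def using S_fin[OF iN] by (simp add: psubset_card_mono)
      then have "i' \<notin> T0 l" using wle[OF lN, of i'] max[OF l(4)] by auto
      then have "y ` T0 l \<subseteq> y ` (T - {i'})" using T0(1)[OF lN] by blast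
      then show "v \<in> span (y ` (T - {i'}))" using T0(2)[OF lN] span_mono l(1) by blast
    qed
    then have "z \<in> span (y ` (T - {i'}))" using z span_minimal[OF _ subspace_span] by blast
    moreover have "g \<in> span (y ` (T - {i'}))"
    proof -
      have "y ` (T0 j \<inter> S j) \<subseteq> y ` (T - {i'})" using T0(1)[OF j] i' by (auto simp: Bad_def)
      then show ?thesis using gz(2) span_mono by blast
    qed
    \<comment> \<open>Both parts of \<open>y j\<close> avoid \<open>i'\<close>, although
      \<open>i'\<close> belongs to \<open>T0 j\<close>; exchanging back puts \<open>y i'\<close> in
      the span of the other basis vectors.\<close>
    ultimately have "y j \<in> span (y ` (T - {i'}))" by (simp add: gz(1) span_add)
    moreover have "y i' \<in> span (insert (y j) (y ` (T - {i'})))"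
      using ex[OF j] i' by (auto simp: Bad_def)
    ultimately have "y i' \<in> span (y ` (T - {i'}))" by (simp add: span_redundant)
    then show False using indep i' BadT by blast
  qed
  show ?thesis
  proof (intro exI[of _ T] conjI ballI)
    show "T \<subseteq> N" by (rule TN)
    show inj: "inj_on y T"
    proof (rule inj_onI, rule ccontr)
      fix i i' assume "i \<in> T" "i' \<in> T" "y i = y i'" "i \<noteq> i'"
      then have "y i \<in> y ` (T - {i})" by auto
      then have "y i \<in> span (y ` (T - {i}))" by (rule span_base)
      then show False using indep[OF \<open>i \<in> T\<close>] by simp
    qed
    have "y ` T - {y i} = y ` (T - {i})" if "i \<in> T" for i using inj that by (auto simp: inj_on_def)
    then show "independent (y ` T)" unfolding dependent_def using indep by auto
    show "y ` U \<subseteq> span (y ` (T \<inter> U))" if "U \<in> \<U>" for U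
    proof (rule image_subsetI)
      fix j assume "j \<in> U"
      then have "j \<in> N" using that sub by blast
      have "y ` T0 j \<subseteq> y ` (T \<inter> U)" 
        using main[OF \<open>j \<in> N\<close>] T0(1)[OF \<open>j \<in> N\<close>] S_least[OF that \<open>j \<in> U\<close>] by blast
      then show "y j \<in> span (y ` (T \<inter> U))" using T0(2)[OF \<open>j \<in> N\<close>] span_mono by blast
    qed
  qed
qed

text \<open>Coordinate form of the adapted basis: \<open>t\<close> enumerates its indices,
  \<open>c j r\<close> is the coordinate of \<open>y j\<close> along \<open>y (t r)\<close>, and
  adaptedness becomes the vanishing of coordinates. The numbering by \<open>{1..m}\<close> prepares
  for the variables of a polynomial ring.\<close>

lemma distributive_family_coordinates:
  fixes y :: "'i \<Rightarrow> 'b"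
  assumes fin: "finite N"
    and sub: "\<U> \<subseteq> Pow N" and top: "N \<in> \<U>"
    and Int: "\<And>A B. A \<in> \<U> \<Longrightarrow> B \<in> \<U> \<Longrightarrow> A \<inter> B \<in> \<U>"
    and Un: "\<And>A B. A \<in> \<U> \<Longrightarrow> B \<in> \<U> \<Longrightarrow> A \<union> B \<in> \<U>"
    and cap: "\<And>A B. A \<in> \<U> \<Longrightarrow> B \<in> \<U> \<Longrightarrow> span (y ` A) \<inter> span (y ` B) \<subseteq> span (y ` (A \<inter> B))"
  shows "\<exists>t (m::nat) c. t ` {1..m} \<subseteq> N
    \<and> (\<forall>a. (\<Sum>r\<in>{1..m}. a r *s y (t r)) = 0 \<longrightarrow> (\<forall>r\<in>{1..m}. a r = 0))
    \<and> (\<forall>j\<in>N. y j = (\<Sum>r\<in>{1..m}. c j r *s y (t r)))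
    \<and> (\<forall>U\<in>\<U>. \<forall>j\<in>U. \<forall>r\<in>{1..m}. t r \<notin> U \<longrightarrow> c j r = 0)"
proof -
  have "\<exists>T\<subseteq>N. inj_on y T \<and> independent (y ` T) \<and> (\<forall>U\<in>\<U>. y ` U \<subseteq> span (y ` (T \<inter> U)))"
    by (rule distributive_family_basis) (fact assms)+
  then obtain T where T: "T \<subseteq> N" "inj_on y T" "independent (y ` T)"
    "\<And>U. U \<in> \<U> \<Longrightarrow> y ` U \<subseteq> span (y ` (T \<inter> U))"
    by (elim exE conjE) (rule that, assumption+, rule bspec)
  have finT: "finite T" using T(1) fin finite_subset by blast
  obtain t where t: "bij_betw t {1..card T} T" using ex_bij_betw_nat_finite_1[OF finT] by blast
  have "bij_betw y T (y ` T)" using T(2) by (simp add: inj_on_imp_bij_betw)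
  then have yt: "bij_betw (y \<circ> t) {1..card T} (y ` T)" using t by (rule bij_betw_trans[rotated])
  define c where "c j r = representation (y ` T) (y j) (y (t r))" for j r
  show ?thesis
  proof (intro exI[of _ t] exI[of _ "card T"] exI[of _ c] conjI allI ballI impI)
    show "t ` {1..card T} \<subseteq> N" using t T(1) by (simp add: bij_betw_imp_surj_on)
    show "a r = 0" if eq: "(\<Sum>r\<in>{1..card T}. a r *s y (t r)) = 0" and r: "r \<in> {1..card T}" for a r
    proof -
      define g where "g = inv_into {1..card T} (y \<circ> t)"
      have g: "g (y (t r)) = r" if "r \<in> {1..card T}" for r
        using bij_betw_inv_into_left[OF yt that] by (simp add: g_def)
      have "(\<Sum>v\<in>y ` T. a (g v) *s v) = (\<Sum>r\<in>{1..card T}. a (g ((y \<circ> t) r)) *s (y \<circ> t) r)"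
        using sum.reindex_bij_betw[OF yt, of "\<lambda>v. a (g v) *s v"] by simp
      also have "\<dots> = 0" using eq g by simp
      finally have *: "(\<Sum>v\<in>y ` T. a (g v) *s v) = 0" .
      have "t r \<in> T" using t r by (auto simp: bij_betw_def)
      then have "a (g (y (t r))) = 0"
        using independentD[OF T(3) _ _ *, of "y (t r)"] finT by simp
      then show ?thesis using g[OF r] by simp
    qed
    show "y j = (\<Sum>r\<in>{1..card T}. c j r *s y (t r))" if "j \<in> N" for j
    proof -
      have "y j \<in> span (y ` T)" using T(4)[OF top] T(1) that by (auto simp: Int_absorb2)
      then have "y j = (\<Sum>v\<in>y ` T. representation (y ` T) (y j) v *s v)"
        using sum_representation_eq[OF T(3), of "y j" "y ` T"] finT by simp
      also have "\<dots> = (\<Sum>r\<in>{1..card T}. c j r *s y (t r))"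
        using sum.reindex_bij_betw[OF yt, of "\<lambda>v. representation (y ` T) (y j) v *s v"]
        by (simp add: c_def)
      finally show ?thesis .
    qed
    show "c j r = 0" if U: "U \<in> \<U>" "j \<in> U" and r: "r \<in> {1..card T}" "t r \<notin> U" for U j r
    proof (rule ccontr)
      have "t r \<in> T" using t r(1) by (auto simp: bij_betw_def)
      have *: "y j \<in> span (y ` (T \<inter> U))" using T(4) U by blast
      assume "c j r \<noteq> 0"
      \<comment> \<open>The expansion in the part of the basis that belongs to \<open>U\<close> is
        also the expansion in the whole basis, so a nonzero coordinate singles out a vector of that
        part. Injectivity of \<open>y\<close> on \<open>T\<close> then puts \<open>t r\<close> in
        \<open>U\<close>.\<close>
      then have "representation (y ` (T \<inter> U)) (y j) (y (t r)) \<noteq> 0"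
        using representation_extend[OF T(3) *] by (simp add: c_def image_mono)
      then have "y (t r) \<in> y ` (T \<inter> U)" by (rule representation_ne_zero)
      then show False using T(2) \<open>t r \<in> T\<close> r(2) by (auto dest: inj_onD)
    qed
  qed
qed

end

section \<open>Substitution in polynomials\<close>

abbreviation keys :: "('a \<Rightarrow>\<^sub>0 'b::zero) \<Rightarrow> 'a set" where "keys \<equiv> Poly_Mapping.keys"

abbreviation lookup :: "('a \<Rightarrow>\<^sub>0 'b::zero) \<Rightarrow> 'a \<Rightarrow> 'b" where "lookup \<equiv> Poly_Mapping.lookup"

text \<open>Exponents are natural numbers, so nothing cancels when monomials are multiplied.\<close>

lemma keys_plus_nat: "keys (a + b :: 'a \<Rightarrow>\<^sub>0 nat) = keys a \<union> keys b"
  by (auto simp: in_keys_iff lookup_add)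

lemma poly_mapping_eq_sum: "(\<Sum>a\<in>keys p. Poly_Mapping.single a (lookup p a)) = p"
proof (rule poly_mapping_eqI)
  fix b
  have "(\<Sum>a\<in>keys p. lookup (Poly_Mapping.single a (lookup p a)) b)
      = (\<Sum>a\<in>keys p. if a = b then lookup p b else 0)"
    by (intro sum.cong) (auto simp: lookup_single)
  then show "lookup (\<Sum>a\<in>keys p. Poly_Mapping.single a (lookup p a)) b = lookup p b"
    by (auto simp: lookup_sum in_keys_iff)
qed

definition const :: "'k::field \<Rightarrow> 'k mpolynomial" where
  "const c = Poly_Mapping.single 0 c"

definition var :: "nat \<Rightarrow> 'k::field mpolynomial" where
  "var i = Poly_Mapping.single (Poly_Mapping.single i 1) 1"

definition mono_subst :: "(nat \<Rightarrow> 'k::field mpolynomial) \<Rightarrow> (nat \<Rightarrow>\<^sub>0 nat) \<Rightarrow> 'k mpolynomial" where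
  "mono_subst f a = (\<Prod>j\<in>keys a. f j ^ lookup a j)"

definition subst :: "(nat \<Rightarrow> 'k::field mpolynomial) \<Rightarrow> 'k mpolynomial \<Rightarrow> 'k mpolynomial" where
  "subst f p = (\<Sum>a\<in>keys p. const (lookup p a) * mono_subst f a)"

lemma const_add: "const (c + d) = const c + const d"
  and const_mult: "const (c * d) = const c * const d"
  and const_0 [simp]: "const 0 = 0"
  and const_1 [simp]: "const 1 = 1"
  by (simp_all add: const_def single_add mult_single)

lemma mono_subst_superset:
  "finite A \<Longrightarrow> keys a \<subseteq> A \<Longrightarrow> mono_subst f a = (\<Prod>j\<in>A. f j ^ lookup a j)"
  unfolding mono_subst_def by (rule prod.mono_neutral_left) (auto simp: in_keys_iff)

lemma mono_subst_0 [simp]: "mono_subst f 0 = 1"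
  by (simp add: mono_subst_def)

lemma mono_subst_add: "mono_subst f (a + b) = mono_subst f a * mono_subst f b"
proof -
  let ?A = "keys a \<union> keys b"
  have "mono_subst f (a + b) = (\<Prod>j\<in>?A. f j ^ lookup (a + b) j)"
    by (rule mono_subst_superset) (auto simp: keys_plus_nat)
  then show ?thesis
    by (simp add: mono_subst_superset[of ?A a] mono_subst_superset[of ?A b]
        lookup_add power_add prod.distrib)
qed

lemma subst_superset:
  "finite A \<Longrightarrow> keys p \<subseteq> A \<Longrightarrow> subst f p = (\<Sum>a\<in>A. const (lookup p a) * mono_subst f a)"
  unfolding subst_def by (rule sum.mono_neutral_left) (auto simp: in_keys_iff)

lemma subst_0 [simp]: "subst f 0 = 0"
  by (simp add: subst_def)

lemma subst_add: "subst f (p + q) = subst f p + subst f q"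
proof -
  let ?A = "keys p \<union> keys q"
  have "subst f (p + q) = (\<Sum>a\<in>?A. const (lookup (p + q) a) * mono_subst f a)"
    by (rule subst_superset) (simp_all add: keys_add)
  then show ?thesis
    by (simp add: subst_superset[of ?A p] subst_superset[of ?A q]
        lookup_add const_add distrib_right sum.distrib)
qed

lemma subst_sum: "subst f (\<Sum>i\<in>A. g i) = (\<Sum>i\<in>A. subst f (g i))"
  by (induction A rule: infinite_finite_induct) (simp_all add: subst_add)

lemma subst_single: "subst f (Poly_Mapping.single a c) = const c * mono_subst f a"
  by (cases "c = 0") (simp_all add: subst_def)

lemma subst_mult: "subst f (p * q) = subst f p * subst f q"
proof -
  let ?s = "\<lambda>p a. Poly_Mapping.single a (lookup p a)"
  have "p * q = (\<Sum>a\<in>keys p. ?s p a) * (\<Sum>b\<in>keys q. ?s q b)"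
    by (simp only: poly_mapping_eq_sum)
  then have "subst f (p * q) = (\<Sum>a\<in>keys p. \<Sum>b\<in>keys q. subst f (?s p a) * subst f (?s q b))"
    by (simp add: sum_product subst_sum mult_single subst_single const_mult mono_subst_add mult_ac)
  also have "\<dots> = (\<Sum>a\<in>keys p. subst f (?s p a)) * (\<Sum>b\<in>keys q. subst f (?s q b))"
    by (simp add: sum_product)
  also have "\<dots> = subst f p * subst f q"
    by (simp add: poly_mapping_eq_sum flip: subst_sum)
  finally show ?thesis .
qed

lemma subst_const [simp]: "subst f (const c) = const c"
  by (simp add: const_def[of c] subst_single)

lemma subst_1 [simp]: "subst f 1 = 1"
  using subst_const[of f 1] by simp

lemma subst_var [simp]: "subst f (var i) = f i"
  by (simp add: var_def subst_single mono_subst_def)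

lemma subst_uminus: "subst f (- p) = - subst f p"
  using subst_add[of f p "- p"] by (simp add: eq_neg_iff_add_eq_0 add.commute)

lemma subst_diff: "subst f (p - q) = subst f p - subst f q"
  using subst_add[of f p "- q"] by (simp add: subst_uminus)

lemma subst_power: "subst f (p ^ k) = subst f p ^ k"
  by (induction k) (simp_all add: subst_mult)

lemma subst_prod: "subst f (\<Prod>i\<in>A. g i) = (\<Prod>i\<in>A. subst f (g i))"
  by (induction A rule: infinite_finite_induct) (simp_all add: subst_mult)

text \<open>A substitution fixes constants and commutes with sums, products and powers, so it passes
  through to the values \<open>f j\<close>. Identities between composites thereby reduce to
  identities on variables.\<close>

lemma subst_subst: "subst g (subst f p) = subst (\<lambda>j. subst g (f j)) p"
  unfolding subst_def[of f] subst_def[of "\<lambda>j. subst g (f j)"] mono_subst_def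
  by (simp add: subst_sum subst_mult subst_prod subst_power)

lemma mono_subst_var: "mono_subst var a = Poly_Mapping.single a 1"
proof -
  have pow: "(var j :: 'a mpolynomial) ^ k = Poly_Mapping.single (Poly_Mapping.single j k) 1" for j k
    by (induction k) (simp_all add: var_def mult_single flip: single_add)
  have "(\<Prod>j\<in>A. Poly_Mapping.single (g j) (1::'a)) = Poly_Mapping.single (\<Sum>j\<in>A. g j) 1"
    for A and g :: "nat \<Rightarrow> nat \<Rightarrow>\<^sub>0 nat"
    by (induction A rule: infinite_finite_induct) (simp_all add: mult_single)
  then show ?thesis
    by (simp add: mono_subst_def pow poly_mapping_eq_sum)
qed

lemma subst_var_id: "subst var p = p"
proof -
  have "subst var p = (\<Sum>a\<in>keys p. Poly_Mapping.single a (lookup p a))"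
    by (simp add: subst_def mono_subst_var const_def mult_single)
  then show ?thesis by (simp add: poly_mapping_eq_sum)
qed

lemma poly_expansion: "p = (\<Sum>a\<in>keys p. const (lookup p a) * (\<Prod>j\<in>keys a. var j ^ lookup a j))"
  using subst_var_id[of p] unfolding subst_def mono_subst_def by (rule sym)

section \<open>The polynomial ring in finitely many variables\<close>

lemma carrier_poly_ring: "carrier (poly_ring n) = {p. \<forall>a\<in>keys p. keys a \<subseteq> {1..n}}"
  by (simp add: poly_ring_def)

lemma poly_ring_keysD:
  "p \<in> carrier (poly_ring n) \<Longrightarrow> a \<in> keys p \<Longrightarrow> j \<in> keys a \<Longrightarrow> j \<in> {1..n}"
  unfolding carrier_poly_ring by blast

lemma subst_cong:
  assumes p: "p \<in> carrier (poly_ring n)" and fg: "\<And>j. j \<in> {1..n} \<Longrightarrow> f j = g j"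
  shows "subst f p = subst g p"
proof -
  have "mono_subst f a = mono_subst g a" if "a \<in> keys p" for a
    unfolding mono_subst_def
  proof (rule prod.cong)
    fix j assume "j \<in> keys a"
    then have "j \<in> {1..n}" using p that by (rule poly_ring_keysD[rotated 2])
    then show "f j ^ lookup a j = g j ^ lookup a j" by (simp only: fg)
  qed simp
  then show ?thesis by (simp add: subst_def)
qed

lemma poly_ring_add: "p \<in> carrier (poly_ring n) \<Longrightarrow> q \<in> carrier (poly_ring n) \<Longrightarrow> p + q \<in> carrier (poly_ring n)"
  unfolding carrier_poly_ring using keys_add[of p q] by blast

lemma poly_ring_mult: "p \<in> carrier (poly_ring n) \<Longrightarrow> q \<in> carrier (poly_ring n) \<Longrightarrow> p * q \<in> carrier (poly_ring n)"
  unfolding carrier_poly_ring using keys_mult[of p q] by (fastforce simp: keys_plus_nat)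

lemma poly_ring_const [simp]: "const c \<in> carrier (poly_ring n)"
  by (simp add: carrier_poly_ring const_def)

lemma poly_ring_0 [simp]: "0 \<in> carrier (poly_ring n)"
  and poly_ring_1 [simp]: "1 \<in> carrier (poly_ring n)"
  using poly_ring_const[of 0 n] poly_ring_const[of 1 n] by (simp_all del: poly_ring_const)

lemma poly_ring_var [simp]: "j \<in> {1..n} \<Longrightarrow> var j \<in> carrier (poly_ring n)"
  by (simp add: carrier_poly_ring var_def)

lemma poly_ring_uminus: "p \<in> carrier (poly_ring n) \<Longrightarrow> - p \<in> carrier (poly_ring n)"
  by (simp add: carrier_poly_ring in_keys_iff)

lemma poly_ring_sum: "(\<And>i. i \<in> A \<Longrightarrow> f i \<in> carrier (poly_ring n)) \<Longrightarrow> sum f A \<in> carrier (poly_ring n)"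
  by (induction A rule: infinite_finite_induct) (simp_all add: poly_ring_add)

lemma poly_ring_power: "p \<in> carrier (poly_ring n) \<Longrightarrow> p ^ k \<in> carrier (poly_ring n)"
  by (induction k) (simp_all add: poly_ring_mult)

lemma poly_ring_prod: "(\<And>i. i \<in> A \<Longrightarrow> f i \<in> carrier (poly_ring n)) \<Longrightarrow> prod f A \<in> carrier (poly_ring n)"
  by (induction A rule: infinite_finite_induct) (simp_all add: poly_ring_mult)

lemma poly_ring_subst:
  assumes "p \<in> carrier (poly_ring n)" "\<And>j. j \<in> {1..n} \<Longrightarrow> f j \<in> carrier (poly_ring m)"
  shows "subst f p \<in> carrier (poly_ring m)"
  unfolding subst_def mono_subst_def
  by (intro poly_ring_sum poly_ring_mult poly_ring_const poly_ring_prod poly_ring_power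
      assms(2) poly_ring_keysD[OF assms(1)])

text \<open>Constants and variables generate the ring. The proof carries membership in the carrier
  along with \<open>Q\<close>, so that the cases for sums and products may assume it.\<close>

lemma poly_ring_induct [consumes 1, case_names const var add mult]:
  assumes p: "p \<in> carrier (poly_ring n)"
    and const: "\<And>c. Q (const c)" and var: "\<And>j. j \<in> {1..n} \<Longrightarrow> Q (var j)"
    and add: "\<And>p q. p \<in> carrier (poly_ring n) \<Longrightarrow> q \<in> carrier (poly_ring n) \<Longrightarrow> Q p \<Longrightarrow> Q q \<Longrightarrow> Q (p + q)"
    and mult: "\<And>p q. p \<in> carrier (poly_ring n) \<Longrightarrow> q \<in> carrier (poly_ring n) \<Longrightarrow> Q p \<Longrightarrow> Q q \<Longrightarrow> Q (p * q)"
  shows "Q p"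
proof -
  let ?Q = "\<lambda>p. p \<in> carrier (poly_ring n) \<and> Q p"
  have Q0: "?Q 0" and Q1: "?Q 1" using const[of 0] const[of 1] by auto
  have sum: "?Q (sum f A)" if "\<And>i. i \<in> A \<Longrightarrow> ?Q (f i)" for f and A :: "(nat \<Rightarrow>\<^sub>0 nat) set"
    using that by (induction A rule: infinite_finite_induct) (simp_all add: Q0 add poly_ring_add)
  have prod: "?Q (prod f A)" if "\<And>i. i \<in> A \<Longrightarrow> ?Q (f i)" for f and A :: "nat set"
    using that by (induction A rule: infinite_finite_induct) (simp_all add: Q1 mult poly_ring_mult)
  have power: "?Q (p ^ k)" if "?Q p" for p k
    using that by (induction k) (simp_all add: Q1 mult poly_ring_mult)
  have "?Q (\<Sum>a\<in>keys p. const (lookup p a) * (\<Prod>j\<in>keys a. var j ^ lookup a j))"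
  proof (rule sum)
    fix a assume "a \<in> keys p"
    then have "?Q (\<Prod>j\<in>keys a. var j ^ lookup a j)"
      using poly_ring_keysD[OF p] by (intro prod power conjI poly_ring_var var)
    then show "?Q (const (lookup p a) * (\<Prod>j\<in>keys a. var j ^ lookup a j))"
      by (simp add: const mult poly_ring_mult)
  qed
  then show ?thesis by (simp flip: poly_expansion)
qed

text \<open>For \<open>j\<close> in the support of \<open>a\<close>, \<open>f j\<close> is a factor
  of the product, and each monomial of a product is a monomial of one factor times a monomial of the
  other.\<close>

lemma keys_mono_subst:
  assumes b: "b \<in> keys (mono_subst f a)" and j: "j \<in> keys a"
  shows "\<exists>b'\<in>keys (f j). keys b' \<subseteq> keys b"
proof -
  obtain k where k: "lookup a j = Suc k" using j by (auto simp: in_keys_iff gr0_conv_Suc)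
  have "mono_subst f a = f j * (f j ^ k * (\<Prod>i\<in>keys a - {j}. f i ^ lookup a i))"
    using j by (simp add: mono_subst_def prod.remove k mult.assoc)
  then obtain b' b'' where "b = b' + b''" "b' \<in> keys (f j)"
    using b subsetD[OF keys_mult] by fastforce
  then show ?thesis by (auto simp: keys_plus_nat)
qed

section \<open>Homomorphisms of Stanley-Reisner rings\<close>

lemma poly_ring_ops [simp]:
  "x \<oplus>\<^bsub>poly_ring n\<^esub> y = x + y" "x \<otimes>\<^bsub>poly_ring n\<^esub> y = x * y"
  "\<zero>\<^bsub>poly_ring n\<^esub> = 0" "\<one>\<^bsub>poly_ring n\<^esub> = 1"
  by (simp_all add: poly_ring_def cring_class_ops_def)

lemma cring_poly_ring: "cring (poly_ring n :: 'k::field mpolynomial ring)"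
proof (rule cringI)
  show "abelian_group (poly_ring n :: 'k mpolynomial ring)"
  proof (rule abelian_groupI)
    fix x :: "'k mpolynomial" assume "x \<in> carrier (poly_ring n)"
    then show "\<exists>y\<in>carrier (poly_ring n). y \<oplus>\<^bsub>poly_ring n\<^esub> x = \<zero>\<^bsub>poly_ring n\<^esub>"
      by (intro bexI[of _ "- x"]) (simp_all add: poly_ring_uminus)
  qed (simp_all add: poly_ring_add ac_simps)
  show "comm_monoid (poly_ring n :: 'k mpolynomial ring)"
    by (rule comm_monoidI) (auto simp: poly_ring_mult ac_simps)
qed (simp add: distrib_right)

lemma poly_ring_a_inv:
  assumes "x \<in> carrier (poly_ring n)" shows "\<ominus>\<^bsub>poly_ring n\<^esub> x = - x"
proof -
  interpret cring "poly_ring n" by (rule cring_poly_ring)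
  show ?thesis using assms by (intro minus_equality) (auto simp: poly_ring_uminus)
qed

lemma poly_ring_minus:
  "x \<in> carrier (poly_ring n) \<Longrightarrow> y \<in> carrier (poly_ring n) \<Longrightarrow> x \<ominus>\<^bsub>poly_ring n\<^esub> y = x - y"
  by (simp add: a_minus_def poly_ring_a_inv)

section \<open>Membership in the Stanley-Reisner ideal\<close>

lemma ideal_SR_ideal: "ideal (SR_ideal n \<Delta>) (poly_ring n)"
proof -
  interpret cring "poly_ring n" by (rule cring_poly_ring)
  show ?thesis unfolding SR_ideal_def by (rule genideal_ideal) (auto simp: carrier_poly_ring)
qed

lemma SR_ideal_0: "0 \<in> SR_ideal n \<Delta>"
  using additive_subgroup.zero_closed[OF ideal.axioms(1)[OF ideal_SR_ideal[of n \<Delta>]]] by simp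

lemma SR_ideal_add: "p \<in> SR_ideal n \<Delta> \<Longrightarrow> q \<in> SR_ideal n \<Delta> \<Longrightarrow> p + q \<in> SR_ideal n \<Delta>"
  using additive_subgroup.a_closed[OF ideal.axioms(1)[OF ideal_SR_ideal[of n \<Delta>]], of p q] by simp

lemma SR_ideal_sum: "(\<And>i. i \<in> A \<Longrightarrow> f i \<in> SR_ideal n \<Delta>) \<Longrightarrow> sum f A \<in> SR_ideal n \<Delta>"
  by (induction A rule: infinite_finite_induct) (simp_all add: SR_ideal_0 SR_ideal_add)

lemma SR_ideal_const_mult: "p \<in> SR_ideal n \<Delta> \<Longrightarrow> const c * p \<in> SR_ideal n \<Delta>"
  using ideal.I_l_closed[OF ideal_SR_ideal[of n \<Delta>], of p "const c"] by simp

lemma simplicial_complex_mono: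
  "simplicial_complex n \<Delta> \<Longrightarrow> F \<in> \<Delta> \<Longrightarrow> F' \<subseteq> F \<Longrightarrow> F' \<in> \<Delta>"
  unfolding simplicial_complex_def by blast

text \<open>Multiplying monomials enlarges supports, and sets containing a nonface are nonfaces;
  hence the linear span of the generators is already an ideal. Membership can therefore be tested
  one exponent vector at a time.\<close>

lemma SR_ideal_eq:
  assumes \<Delta>: "simplicial_complex n \<Delta>"
  shows "(SR_ideal n \<Delta> :: 'k::field mpolynomial set) = {p. \<forall>a\<in>keys p. keys a \<subseteq> {1..n} \<and> keys a \<notin> \<Delta>}" (is "_ = ?I")
proof -
  interpret cring "poly_ring n" by (rule cring_poly_ring)
  let ?S = "{Poly_Mapping.single a 1 | a. keys a \<subseteq> {1..n} \<and> keys a \<notin> \<Delta>}"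
  have S: "?S \<subseteq> carrier (poly_ring n)" by (auto simp: carrier_poly_ring)
  have IP: "?I \<subseteq> carrier (poly_ring n)" by (auto simp: carrier_poly_ring)
  have add: "p + q \<in> ?I" if "p \<in> ?I" "q \<in> ?I" for p q
    using that keys_add[of p q] by blast
  have mult: "p * q \<in> ?I" if "p \<in> ?I" "q \<in> carrier (poly_ring n)" for p q
  proof
    have "keys (a + b) \<subseteq> {1..n} \<and> keys (a + b) \<notin> \<Delta>" if "a \<in> keys p" "b \<in> keys q" for a b
      using \<open>p \<in> ?I\<close> \<open>q \<in> carrier (poly_ring n)\<close> that simplicial_complex_mono[OF \<Delta>, of "keys (a + b)" "keys a"]
      unfolding carrier_poly_ring keys_plus_nat by blast
    then show "\<forall>a\<in>keys (p * q). keys a \<subseteq> {1..n} \<and> keys a \<notin> \<Delta>"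
      using keys_mult[of p q] by blast
  qed
  have "ideal ?I (poly_ring n)"
  proof (rule idealI)
    show "ring (poly_ring n)" by (rule ring_axioms)
    show "subgroup ?I (add_monoid (poly_ring n))"
    proof (rule subgroup.intro)
      fix x assume x: "x \<in> ?I"
      then have "- x \<in> ?I" by (simp add: in_keys_iff)
      moreover have "inv\<^bsub>add_monoid (poly_ring n)\<^esub> x = - x"
        using poly_ring_a_inv[of x n] x IP unfolding a_inv_def by blast
      ultimately show "inv\<^bsub>add_monoid (poly_ring n)\<^esub> x \<in> ?I" by (simp only:)
    next
      show "?I \<subseteq> carrier (add_monoid (poly_ring n))" using IP by simp
      show "x \<otimes>\<^bsub>add_monoid (poly_ring n)\<^esub> y \<in> ?I" if "x \<in> ?I" "y \<in> ?I" for x y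
        using add[OF that] by (simp only: monoid.simps poly_ring_ops)
    qed simp
  next
    fix p x :: "'k mpolynomial" assume "p \<in> ?I" "x \<in> carrier (poly_ring n)"
    then have "p * x \<in> ?I" by (rule mult)
    then show "p \<otimes>\<^bsub>poly_ring n\<^esub> x \<in> ?I" "x \<otimes>\<^bsub>poly_ring n\<^esub> p \<in> ?I"
      by (simp_all only: poly_ring_ops mult.commute)
  qed
  then have "SR_ideal n \<Delta> \<subseteq> ?I"
    unfolding SR_ideal_def by (rule genideal_minimal) auto
  moreover have "?I \<subseteq> SR_ideal n \<Delta>"
  proof
    fix p assume p: "p \<in> ?I"
    have "const (lookup p a) * Poly_Mapping.single a 1 \<in> SR_ideal n \<Delta>" if "a \<in> keys p" for a
    proof -
      have "Poly_Mapping.single a 1 \<in> SR_ideal n \<Delta>"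
        unfolding SR_ideal_def by (rule subsetD[OF genideal_self[OF S]]) (use p that in blast)
      then show ?thesis by (rule SR_ideal_const_mult)
    qed
    then have "(\<Sum>a\<in>keys p. Poly_Mapping.single a (lookup p a)) \<in> SR_ideal n \<Delta>"
      by (intro SR_ideal_sum) (simp add: const_def mult_single)
    then show "p \<in> SR_ideal n \<Delta>" by (simp add: poly_mapping_eq_sum)
  qed
  ultimately show ?thesis by blast
qed

section \<open>Residue classes and maps induced by substitutions\<close>

lemma SR_class_eq_iff:
  assumes p: "p \<in> carrier (poly_ring n)" and q: "q \<in> carrier (poly_ring n)"
  shows "SR_class n \<Delta> p = SR_class n \<Delta> q \<longleftrightarrow> p - q \<in> SR_ideal n \<Delta>"
proof -
  interpret ideal "SR_ideal n \<Delta>" "poly_ring n" by (rule ideal_SR_ideal)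
  have "SR_class n \<Delta> p = SR_class n \<Delta> q \<longleftrightarrow> p \<in> SR_class n \<Delta> q"
    unfolding SR_class_def using a_repr_independence' a_repr_independenceD p q by metis
  also have "\<dots> \<longleftrightarrow> p - q \<in> SR_ideal n \<Delta>"
    unfolding SR_class_def using a_rcos_module_minus[OF ring_axioms q p] p q
    by (simp add: poly_ring_minus)
  finally show ?thesis .
qed

lemma SR_class_hom: "SR_class n \<Delta> \<in> ring_hom (poly_ring n) (SR_ring n \<Delta>)"
  using ideal.rcos_ring_hom[OF ideal_SR_ideal[of n \<Delta>]]
  unfolding SR_class_def[abs_def] by (simp add: SR_ring_def ring.defs ring_hom_def)

lemmas SR_class_add = ring_hom_add[OF SR_class_hom, symmetric, simplified]
  and SR_class_mult = ring_hom_mult[OF SR_class_hom, symmetric, simplified]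
  and SR_class_1 = ring_hom_one[OF SR_class_hom, symmetric, simplified]

lemma SR_class_smult:
  assumes "p \<in> carrier (poly_ring n)"
  shows "c \<odot>\<^bsub>SR_ring n \<Delta>\<^esub> SR_class n \<Delta> p = SR_class n \<Delta> (const c * p)"
  using SR_class_mult[OF poly_ring_const[of c n] assms, of \<Delta>]
  by (simp add: SR_ring_def ring.defs module.defs flip: const_def)

lemma carrier_SR_ring: "carrier (SR_ring n \<Delta>) = SR_class n \<Delta> ` carrier (poly_ring n)"
  by (auto simp: SR_ring_def SR_class_def ring.defs FactRing_def A_RCOSETS_def')

lemma SR_class_closed [simp]: "p \<in> carrier (poly_ring n) \<Longrightarrow> SR_class n \<Delta> p \<in> carrier (SR_ring n \<Delta>)"
  by (simp add: carrier_SR_ring)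

text \<open>The map induced on residue classes. A representative is picked by \<open>SOME\<close>;
  the choice is harmless once the substitution maps one ideal into the other, as in
  \<open>SR_subst_class\<close>.\<close>

definition SR_subst ::
    "nat \<Rightarrow> nat set set \<Rightarrow> nat \<Rightarrow> nat set set \<Rightarrow> (nat \<Rightarrow> 'k::field mpolynomial) \<Rightarrow>
     'k mpolynomial set \<Rightarrow> 'k mpolynomial set" where
  "SR_subst n \<Delta> m \<Delta>' f Y =
     SR_class m \<Delta>' (subst f (SOME p. p \<in> carrier (poly_ring n) \<and> Y = SR_class n \<Delta> p))"

lemma SR_subst_class:
  assumes p: "p \<in> carrier (poly_ring n)"
    and f: "\<And>j. j \<in> {1..n} \<Longrightarrow> f j \<in> carrier (poly_ring m)"
    and I: "\<And>p. p \<in> SR_ideal n \<Delta> \<Longrightarrow> subst f p \<in> SR_ideal m \<Delta>'"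
  shows "SR_subst n \<Delta> m \<Delta>' f (SR_class n \<Delta> p) = SR_class m \<Delta>' (subst f p)"
proof -
  define q where "q = (SOME q. q \<in> carrier (poly_ring n) \<and> SR_class n \<Delta> p = SR_class n \<Delta> q)"
  have q: "q \<in> carrier (poly_ring n) \<and> SR_class n \<Delta> p = SR_class n \<Delta> q"
    unfolding q_def by (rule someI[of _ p]) (simp add: p)
  then have "p - q \<in> SR_ideal n \<Delta>" using p SR_class_eq_iff[of p n q \<Delta>] by simp
  then have "subst f p - subst f q \<in> SR_ideal m \<Delta>'" unfolding subst_diff[symmetric] by (rule I)
  moreover have "subst f p \<in> carrier (poly_ring m)" "subst f q \<in> carrier (poly_ring m)"
    using p q by (auto intro: poly_ring_subst f)
  ultimately show ?thesis
    using SR_class_eq_iff[of "subst f p" m "subst f q" \<Delta>'] by (simp add: SR_subst_def flip: q_def)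
qed

lemma SR_subst_hom:
  assumes f: "\<And>j. j \<in> {1..n} \<Longrightarrow> f j \<in> carrier (poly_ring m)"
    and I: "\<And>p. p \<in> SR_ideal n \<Delta> \<Longrightarrow> subst f p \<in> SR_ideal m \<Delta>'"
  shows "SR_subst n \<Delta> m \<Delta>' f \<in> algebra_hom K (SR_ring n \<Delta>) (SR_ring m \<Delta>')"
proof -
  have [simp]: "SR_subst n \<Delta> m \<Delta>' f (SR_class n \<Delta> p) = SR_class m \<Delta>' (subst f p)"
    if "p \<in> carrier (poly_ring n)" for p
    by (rule SR_subst_class[OF that f I])
  have [simp]: "subst f p \<in> carrier (poly_ring m)" if "p \<in> carrier (poly_ring n)" for p
    using poly_ring_subst[OF that f] .
  show ?thesis
    unfolding algebra_hom_def ring_hom_def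
    by (auto simp: carrier_SR_ring SR_class_add SR_class_mult SR_class_1 SR_class_smult
        poly_ring_add poly_ring_mult subst_add subst_mult)
qed

text \<open>By \<open>SR_ideal_eq\<close>, elements of the ideal are combinations of monomials with
  nonface support, so only these need to be checked.\<close>

lemma subst_SR_ideal:
  assumes \<Delta>: "simplicial_complex n \<Delta>"
    and f: "\<And>a. keys a \<subseteq> {1..n} \<Longrightarrow> keys a \<notin> \<Delta> \<Longrightarrow> mono_subst f a \<in> SR_ideal m \<Delta>'"
    and p: "p \<in> SR_ideal n \<Delta>"
  shows "subst f p \<in> SR_ideal m \<Delta>'"
  unfolding subst_def
proof (intro SR_ideal_sum SR_ideal_const_mult)
  fix a assume "a \<in> keys p"
  then show "mono_subst f a \<in> SR_ideal m \<Delta>'" using p by (intro f) (auto simp: SR_ideal_eq[OF \<Delta>])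
qed

text \<open>The ring is generated by constants and the classes of the variables, so lifts of the
  images of the variables determine the homomorphism. This trades an abstract homomorphism for a
  substitution.\<close>

lemma SR_hom_eq_subst:
  assumes e: "e \<in> algebra_hom cring_class_ops (SR_ring n \<Delta>) (SR_ring m \<Delta>')"
    and f: "\<And>j. j \<in> {1..n} \<Longrightarrow> f j \<in> carrier (poly_ring m)"
    and eq: "\<And>j. j \<in> {1..n} \<Longrightarrow> e (SR_class n \<Delta> (var j)) = SR_class m \<Delta>' (f j)"
    and p: "p \<in> carrier (poly_ring n)"
  shows "e (SR_class n \<Delta> p) = SR_class m \<Delta>' (subst f p)"
  using p
proof (induction p rule: poly_ring_induct)
  case (const c)
  have "e (c \<odot>\<^bsub>SR_ring n \<Delta>\<^esub> SR_class n \<Delta> 1) = c \<odot>\<^bsub>SR_ring m \<Delta>'\<^esub> SR_class m \<Delta>' 1"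
    using e unfolding algebra_hom_def ring_hom_def by (simp add: carrier_class SR_class_1)
  then show ?case by (simp add: SR_class_smult)
next
  case (add p q)
  then have "e (SR_class n \<Delta> p \<oplus>\<^bsub>SR_ring n \<Delta>\<^esub> SR_class n \<Delta> q) =
      SR_class m \<Delta>' (subst f p) \<oplus>\<^bsub>SR_ring m \<Delta>'\<^esub> SR_class m \<Delta>' (subst f q)"
    using e unfolding algebra_hom_def ring_hom_def by simp
  then show ?case using add poly_ring_subst[OF _ f] by (simp add: SR_class_add subst_add)
next
  case (mult p q)
  then have "e (SR_class n \<Delta> p \<otimes>\<^bsub>SR_ring n \<Delta>\<^esub> SR_class n \<Delta> q) =
      SR_class m \<Delta>' (subst f p) \<otimes>\<^bsub>SR_ring m \<Delta>'\<^esub> SR_class m \<Delta>' (subst f q)"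
    using e unfolding algebra_hom_def ring_hom_def by simp
  then show ?case using mult poly_ring_subst[OF _ f] by (simp add: SR_class_mult subst_mult)
qed (simp add: eq)

section \<open>Linear forms\<close>

text \<open>Scalars act through constant polynomials, which makes the results on adapted bases
  available for families of linear forms.\<close>

interpretation mpoly: vector_space "\<lambda>(c::'k::field) (p::'k mpolynomial). const c * p"
  by unfold_locales (simp_all add: const_add const_mult algebra_simps)

definition linear_forms :: "nat set \<Rightarrow> 'k::field mpolynomial set" where
  "linear_forms A = {p. keys p \<subseteq> (\<lambda>j. Poly_Mapping.single j 1) ` A}"

lemma keys_const_mult: "keys (const c * p) \<subseteq> keys p"
  using keys_mult[of "const c" p] by (auto simp: const_def split: if_splits)

lemma keys_sum_subset: "keys (\<Sum>i\<in>A. f i) \<subseteq> (\<Union>i\<in>A. keys (f i))"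
proof (induction A rule: infinite_finite_induct)
  case (insert x F)
  then show ?case using keys_add[of "f x" "sum f F"] by auto
qed simp_all

lemma subspace_linear_forms: "mpoly.subspace (linear_forms A)"
  unfolding mpoly.subspace_def linear_forms_def
proof (intro conjI ballI allI CollectI)
  fix p q :: "'k::field mpolynomial" and c
  assume "p \<in> {p. keys p \<subseteq> (\<lambda>j. Poly_Mapping.single j 1) ` A}"
  then show "keys (const c * p) \<subseteq> (\<lambda>j. Poly_Mapping.single j 1) ` A"
    using keys_const_mult[of c p] by blast
  assume "q \<in> {p. keys p \<subseteq> (\<lambda>j. Poly_Mapping.single j 1) ` A}"
  with \<open>p \<in> _\<close> show "keys (p + q) \<subseteq> (\<lambda>j. Poly_Mapping.single j 1) ` A"
    using keys_add[of p q] by blast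
qed simp

lemma linear_forms_Int: "linear_forms A \<inter> linear_forms B = linear_forms (A \<inter> B)"
proof -
  have "inj (\<lambda>j::nat. Poly_Mapping.single j (1::nat))"
    by (rule injI) (metis keys_single singleton_inject zero_neq_one)
  then show ?thesis unfolding linear_forms_def by (simp only: image_Int) blast
qed

lemma var_in_linear_forms: "j \<in> A \<Longrightarrow> var j \<in> linear_forms A"
  by (auto simp: linear_forms_def var_def)

lemma linear_formsE:
  assumes "p \<in> linear_forms A" "a \<in> keys p"
  obtains j where "j \<in> A" "a = Poly_Mapping.single j 1"
  using assms by (auto simp: linear_forms_def)

text \<open>A sum of natural numbers equals 1 only if exactly one summand is 1 and all others are 0,
  so every exponent vector of \<open>p\<close> is a unit vector.\<close>

lemma homogeneous_1_linear_forms: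
  assumes p: "p \<in> carrier (poly_ring n)" and hom: "homogeneous 1 p"
  shows "p \<in> linear_forms {1..n}"
  unfolding linear_forms_def
proof (intro CollectI subsetI)
  fix a assume a: "a \<in> keys p"
  then have "int (\<Sum>j\<in>keys a. lookup a j) = 1" using hom unfolding homogeneous_def by blast
  then have "(\<Sum>j\<in>keys a. lookup a j) = Suc 0" by linarith
  then obtain j where j: "j \<in> keys a" "lookup a j = Suc 0" "\<And>i. i \<in> keys a \<Longrightarrow> j \<noteq> i \<Longrightarrow> lookup a i = 0"
    by (auto simp: sum_eq_Suc0_iff)
  have "a = Poly_Mapping.single j 1"
    by (rule poly_mapping_eqI) (use j in \<open>auto simp: lookup_single when_def in_keys_iff\<close>)
  then show "a \<in> (\<lambda>j. Poly_Mapping.single j 1) ` {1..n}" using poly_ring_keysD[OF p a j(1)] by blast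
qed

lemma homogeneous_var: "homogeneous 1 (var j)"
  by (simp add: homogeneous_def var_def)

lemma linear_forms_poly_ring: "linear_forms {1..n} \<subseteq> carrier (poly_ring n)"
  by (auto simp: linear_forms_def carrier_poly_ring split: if_splits dest!: subsetD)

lemma mono_subst_single: "mono_subst f (Poly_Mapping.single j 1) = f j"
  by (simp add: mono_subst_def)

lemma subst_linear_form:
  assumes "p \<in> linear_forms A"
  shows "subst f p \<in> mpoly.span (f ` A)"
  unfolding subst_def
proof (intro mpoly.span_sum mpoly.span_scale)
  fix a assume "a \<in> keys p"
  with assms obtain j where "j \<in> A" "a = Poly_Mapping.single j 1" by (rule linear_formsE)
  then show "mono_subst f a \<in> mpoly.span (f ` A)"
    by (simp add: mono_subst_single mpoly.span_base del: One_nat_def)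
qed

lemma linear_form_expansion:
  assumes p: "p \<in> linear_forms A" and A: "finite A"
  shows "p = (\<Sum>j\<in>A. const (lookup p (Poly_Mapping.single j 1)) * var j)"
proof -
  have inj: "inj_on (\<lambda>j. Poly_Mapping.single j (1::nat)) A"
    by (rule inj_onI) (metis keys_single singleton_inject zero_neq_one)
  have "subst var p = (\<Sum>a\<in>(\<lambda>j. Poly_Mapping.single j 1) ` A. const (lookup p a) * mono_subst var a)"
    using p A by (intro subst_superset) (auto simp: linear_forms_def)
  then show ?thesis
    by (simp add: subst_var_id sum.reindex[OF inj] mono_subst_single del: One_nat_def)
qed

text \<open>The substitution is restriction to the coordinate subspace of \<open>F\<close>: a
  monomial in the variables of \<open>F\<close> survives unchanged, and any other monomial contains
  a factor 0.\<close>

lemma lookup_restrict_vars: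
  "lookup (subst (\<lambda>j. if j \<in> F then var j else 0) p) b = (if keys b \<subseteq> F then lookup p b else 0)"
proof -
  have mono: "mono_subst (\<lambda>j. if j \<in> F then var j else 0) a =
      (if keys a \<subseteq> F then Poly_Mapping.single a 1 else 0)" for a
  proof (cases "keys a \<subseteq> F")
    case True
    then have "mono_subst (\<lambda>j. if j \<in> F then var j else 0) a = mono_subst var a"
      unfolding mono_subst_def by (intro prod.cong) auto
    then show ?thesis using True by (simp add: mono_subst_var)
  next
    case False
    then obtain j where "j \<in> keys a" "j \<notin> F" by blast
    then show ?thesis using False unfolding mono_subst_def
      by (auto intro!: bexI[of _ j] simp: prod_zero_iff in_keys_iff)
  qed
  have "lookup (const (lookup p a) * mono_subst (\<lambda>j. if j \<in> F then var j else 0) a) b =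
      (if a = b then if keys b \<subseteq> F then lookup p b else 0 else 0)" for a
    by (auto simp: mono const_def mult_single lookup_single)
  then show ?thesis
    by (simp add: subst_def lookup_sum in_keys_iff)
qed

lemma ex_keys_eq: "finite S \<Longrightarrow> \<exists>a :: nat \<Rightarrow>\<^sub>0 nat. keys a = S"
proof (induction S rule: finite_induct)
  case (insert x S)
  then obtain a :: "nat \<Rightarrow>\<^sub>0 nat" where "keys a = S" by blast
  then have "keys (Poly_Mapping.single x 1 + a) = insert x S" by (simp add: keys_plus_nat)
  then show ?case by blast
qed (auto intro: exI[of _ 0])

lemma mono_subst_poly_ring:
  assumes "keys a \<subseteq> {1..n}" "\<And>j. j \<in> {1..n} \<Longrightarrow> f j \<in> carrier (poly_ring m)"
  shows "mono_subst f a \<in> carrier (poly_ring m)"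
  unfolding mono_subst_def using assms by (intro poly_ring_prod poly_ring_power) blast

section \<open>Idempotent linear endomorphisms\<close>

text \<open>A degree-preserving idempotent endomorphism of the Stanley-Reisner ring, given by lifts
  \<open>y j\<close> of the images of the variables. Idempotence is stated for polynomials rather
  than classes, since no nonzero linear form lies in the ideal.\<close>

locale linear_idempotent =
  fixes n :: nat and \<Delta> :: "nat set set" and y :: "nat \<Rightarrow> 'k::field mpolynomial"
  assumes complex: "simplicial_complex n \<Delta>"
    and y_linear: "\<And>j. j \<in> {1..n} \<Longrightarrow> y j \<in> linear_forms {1..n}"
    and subst_y_ideal: "\<And>p. p \<in> SR_ideal n \<Delta> \<Longrightarrow> subst y p \<in> SR_ideal n \<Delta>"
    and subst_y_y: "\<And>j. j \<in> {1..n} \<Longrightarrow> subst y (y j) = y j"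
begin

text \<open>The indices \<open>i\<close> such that the restriction of \<open>y i\<close> to the coordinate subspace of \<open>F\<close> is nonzero.\<close>
definition nonvanishing :: "nat set \<Rightarrow> nat set" where
  "nonvanishing F = {i \<in> {1..n}. \<exists>j\<in>F. Poly_Mapping.single j 1 \<in> keys (y i)}"

text \<open>
  The sets \<open>U\<close> for which \<open>y\<close> maps the span of the variables in \<open>U\<close> to itself. A face is stable if
  its complement is such a set; the irreducible components of the retract come from stable faces.
\<close>
definition invariant_sets :: "nat set set" where
  "invariant_sets = {U. U \<subseteq> {1..n} \<and> (\<forall>j\<in>U. y j \<in> linear_forms U)}"

lemma finite_complex: "finite \<Delta>"
  using complex unfolding simplicial_complex_def by (meson finite_Pow_iff finite_atLeastAtMost finite_subset)

text \<open>If it were a nonface, a product of powers of the \<open>y i\<close> with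
  \<open>i\<close> in \<open>nonvanishing F\<close> would lie in the ideal and hence vanish on the
  coordinate subspace of the face \<open>F\<close>, while none of its factors does.\<close>

lemma nonvanishing_face:
  assumes F: "F \<in> \<Delta>"
  shows "nonvanishing F \<in> \<Delta>"
proof (rule ccontr)
  assume nonface: "nonvanishing F \<notin> \<Delta>"
  have "finite (nonvanishing F)" by (simp add: nonvanishing_def)
  then obtain a :: "nat \<Rightarrow>\<^sub>0 nat" where a: "keys a = nonvanishing F" using ex_keys_eq by metis
  have "Poly_Mapping.single a 1 \<in> SR_ideal n \<Delta>"
    using a nonface by (auto simp: SR_ideal_eq[OF complex] nonvanishing_def)
  then have "mono_subst y a \<in> SR_ideal n \<Delta>"
    using subst_y_ideal[of "Poly_Mapping.single a 1"] by (simp add: subst_single)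
  then have I: "keys b \<notin> \<Delta>" if "b \<in> keys (mono_subst y a)" for b
    using that by (simp add: SR_ideal_eq[OF complex])
  let ?\<rho> = "\<lambda>j. if j \<in> F then var j else 0 :: 'k mpolynomial"
  have "subst ?\<rho> (mono_subst y a) = 0"
  proof (rule poly_mapping_eqI)
    fix b
    have "lookup (mono_subst y a) b = 0" if "keys b \<subseteq> F"
      using I[of b] simplicial_complex_mono[OF complex F that] by (auto simp: in_keys_iff)
    then show "lookup (subst ?\<rho> (mono_subst y a)) b = lookup 0 b"
      by (simp add: lookup_restrict_vars)
  qed
  \<comment> \<open>The polynomials form an integral domain, so a vanishing product has a vanishing
    factor.\<close>
  then obtain i where i: "i \<in> keys a" "subst ?\<rho> (y i) = 0"
    by (auto simp: mono_subst_def subst_prod subst_power prod_zero_iff)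
  then obtain j where j: "j \<in> F" "Poly_Mapping.single j 1 \<in> keys (y i)"
    by (auto simp: a nonvanishing_def)
  have "lookup (subst ?\<rho> (y i)) (Poly_Mapping.single j 1) = lookup (y i) (Poly_Mapping.single j 1)"
    using j(1) by (simp add: lookup_restrict_vars)
  then show False using i(2) j(2) by (simp add: in_keys_iff)
qed

text \<open>Since \<open>y i\<close> equals \<open>subst y (y i)\<close>, a variable with index
  \<open>j\<close> in \<open>F\<close> that occurs in \<open>y i\<close> must occur in some
  \<open>y l\<close> whose variable \<open>var l\<close> occurs in \<open>y i\<close>. Such an
  \<open>l\<close> belongs to \<open>nonvanishing F\<close>.\<close>

lemma nonvanishing_idem: "nonvanishing F \<subseteq> nonvanishing (nonvanishing F)"
proof
  fix i assume "i \<in> nonvanishing F"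
  then obtain j where i: "i \<in> {1..n}" and j: "j \<in> F" "Poly_Mapping.single j 1 \<in> keys (y i)"
    by (auto simp: nonvanishing_def)
  have "Poly_Mapping.single j 1 \<in> keys (subst y (y i))" using j(2) subst_y_y[OF i] by simp
  then have "Poly_Mapping.single j 1 \<in> (\<Union>a\<in>keys (y i). keys (const (lookup (y i) a) * mono_subst y a))"
    unfolding subst_def by (rule subsetD[OF keys_sum_subset])
  then obtain a where a: "a \<in> keys (y i)" "Poly_Mapping.single j 1 \<in> keys (const (lookup (y i) a) * mono_subst y a)"
    by blast
  have "Poly_Mapping.single j 1 \<in> keys (mono_subst y a)" by (rule subsetD[OF keys_const_mult a(2)])
  moreover obtain l where l: "l \<in> {1..n}" "a = Poly_Mapping.single l 1"
    using linear_formsE[OF y_linear[OF i] a(1)] by blast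
  ultimately have "l \<in> nonvanishing F"
    using j(1) l(1) by (auto simp: nonvanishing_def mono_subst_single simp del: One_nat_def)
  then show "i \<in> nonvanishing (nonvanishing F)"
    using i a(1) l(2) by (auto simp: nonvanishing_def)
qed

text \<open>A maximal face among those that contain \<open>nonvanishing F\<close> and are contained
  in their own \<open>nonvanishing\<close> set is a fixed point of \<open>nonvanishing\<close>, and
  the complement of a fixed point is invariant.\<close>

lemma ex_stable_face:
  assumes F: "F \<in> \<Delta>"
  obtains F' where "F' \<in> \<Delta>" "nonvanishing F \<subseteq> F'" "{1..n} - F' \<in> invariant_sets"
proof -
  define S where "S = {F' \<in> \<Delta>. nonvanishing F \<subseteq> F' \<and> F' \<subseteq> nonvanishing F'}"
  have "finite S" using finite_complex by (simp add: S_def)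
  moreover have "nonvanishing F \<in> S"
    using nonvanishing_face[OF F] nonvanishing_idem by (simp add: S_def)
  ultimately obtain F' where F': "F' \<in> S" and max: "\<forall>F''\<in>S. F' \<subseteq> F'' \<longrightarrow> F' = F''"
    using finite_has_maximal2[of S "nonvanishing F"] by auto
  have "nonvanishing F' \<in> S"
    using F' nonvanishing_face[of F'] nonvanishing_idem[of F'] unfolding S_def by blast
  then have eq: "nonvanishing F' = F'" using max F' unfolding S_def by blast
  have "{1..n} - F' \<in> invariant_sets"
    unfolding invariant_sets_def
  proof (intro CollectI conjI ballI)
    fix j assume j: "j \<in> {1..n} - F'"
    show "y j \<in> linear_forms ({1..n} - F')"
      unfolding linear_forms_def
    proof (intro CollectI subsetI)
      fix a assume a: "a \<in> keys (y j)"
      obtain l where l: "l \<in> {1..n}" "a = Poly_Mapping.single l 1"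
        using linear_formsE[OF y_linear a] j by blast
      \<comment> \<open>An index \<open>l\<close> in \<open>F'\<close> would place \<open>j\<close>
        in \<open>nonvanishing F'\<close>, which is \<open>F'\<close>.\<close>
      then have "l \<notin> F'" using a j eq unfolding nonvanishing_def by blast
      then show "a \<in> (\<lambda>j. Poly_Mapping.single j 1) ` ({1..n} - F')" using l by blast
    qed
  qed blast
  then show ?thesis using that F' unfolding S_def by blast
qed

text \<open>By invariance, an element \<open>z\<close> of both spans only involves variables with
  index in both \<open>A\<close> and \<open>B\<close>, so \<open>subst y z\<close> is a combination
  of the corresponding \<open>y j\<close>. Idempotence gives \<open>subst y z = z\<close> on the
  span of the \<open>y j\<close>.\<close>

lemma span_invariant_Int:
  assumes A: "A \<in> invariant_sets" and B: "B \<in> invariant_sets"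
  shows "mpoly.span (y ` A) \<inter> mpoly.span (y ` B) \<subseteq> mpoly.span (y ` (A \<inter> B))"
proof
  fix z assume z: "z \<in> mpoly.span (y ` A) \<inter> mpoly.span (y ` B)"
  have sub: "mpoly.span (y ` U) \<subseteq> linear_forms U" if "U \<in> invariant_sets" for U
    using that by (intro mpoly.span_minimal subspace_linear_forms) (auto simp: invariant_sets_def)
  have "z \<in> linear_forms (A \<inter> B)"
    using z sub[OF A] sub[OF B] linear_forms_Int[of A B] by blast
  then have "subst y z \<in> mpoly.span (y ` (A \<inter> B))" by (rule subst_linear_form)
  moreover have "mpoly.span (y ` A) \<subseteq> {z. subst y z = z}"
  proof (rule mpoly.span_minimal)
    show "y ` A \<subseteq> {z. subst y z = z}" using A subst_y_y by (auto simp: invariant_sets_def)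
    show "mpoly.subspace {z. subst y z = z}"
      by (auto simp: mpoly.subspace_def subst_add subst_mult)
  qed
  ultimately show "z \<in> mpoly.span (y ` (A \<inter> B))" using z by auto
qed

text \<open>Here \<open>f\<close> and \<open>g\<close> lift mutually inverse maps between the new
  Stanley-Reisner ring and the image of the idempotent: \<open>f\<close> sends each variable to a
  form of the adapted basis, and \<open>g\<close> sends \<open>var j\<close> to the coordinates of
  \<open>y j\<close> in that basis.\<close>

lemma image_is_SR:
  shows "\<exists>m \<Delta>' f g. simplicial_complex m \<Delta>'
    \<and> (\<forall>r\<in>{1..m}. f r \<in> carrier (poly_ring n))
    \<and> (\<forall>j\<in>{1..n}. g j \<in> carrier (poly_ring m))
    \<and> (\<forall>p\<in>SR_ideal m \<Delta>'. subst f p \<in> SR_ideal n \<Delta>)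
    \<and> (\<forall>p\<in>SR_ideal n \<Delta>. subst g p \<in> SR_ideal m \<Delta>')
    \<and> (\<forall>j\<in>{1..n}. subst f (g j) = y j)
    \<and> (\<forall>r\<in>{1..m}. subst g (f r) = var r)
    \<and> (\<forall>r\<in>{1..m}. subst y (f r) = f r)"
proof -
  have top: "{1..n} \<in> invariant_sets" using y_linear by (auto simp: invariant_sets_def)
  have mono: "p \<in> linear_forms A' \<Longrightarrow> A' \<subseteq> A \<Longrightarrow> p \<in> linear_forms A" for p :: "'k mpolynomial" and A' A
    unfolding linear_forms_def by blast
  have Int: "A \<inter> B \<in> invariant_sets" if "A \<in> invariant_sets" "B \<in> invariant_sets" for A B
    using that linear_forms_Int[of A B] by (auto simp: invariant_sets_def)
  have Un: "A \<union> B \<in> invariant_sets" if "A \<in> invariant_sets" "B \<in> invariant_sets" for A B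
    using that unfolding invariant_sets_def by (auto intro: mono)
  have sub: "invariant_sets \<subseteq> Pow {1..n}" by (auto simp: invariant_sets_def)
  have "\<exists>t (m::nat) c. t ` {1..m} \<subseteq> {1..n}
    \<and> (\<forall>a. (\<Sum>r\<in>{1..m}. const (a r) * y (t r)) = 0 \<longrightarrow> (\<forall>r\<in>{1..m}. a r = 0))
    \<and> (\<forall>j\<in>{1..n}. y j = (\<Sum>r\<in>{1..m}. const (c j r) * y (t r)))
    \<and> (\<forall>U\<in>invariant_sets. \<forall>j\<in>U. \<forall>r\<in>{1..m}. t r \<notin> U \<longrightarrow> c j r = 0)"
    by (rule mpoly.distributive_family_coordinates)
      (fact finite_atLeastAtMost sub top Int Un span_invariant_Int)+
  then obtain t m c where t: "t ` {1..m::nat} \<subseteq> {1..n}"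
    and indep: "\<forall>a. (\<Sum>r\<in>{1..m}. const (a r) * y (t r)) = 0 \<longrightarrow> (\<forall>r\<in>{1..m}. a r = 0)"
    and y_eq: "\<forall>j\<in>{1..n}. y j = (\<Sum>r\<in>{1..m}. const (c j r) * y (t r))"
    and adapted: "\<forall>U\<in>invariant_sets. \<forall>j\<in>U. \<forall>r\<in>{1..m}. t r \<notin> U \<longrightarrow> c j r = 0"
    by (elim exE conjE) (rule that)
  have t_mem: "t r \<in> {1..n}" if "r \<in> {1..m}" for r using t that by blast
  define f where "f r = y (t r)" for r
  define g where "g j = (\<Sum>r\<in>{1..m}. const (c j r) * var r)" for j
  have g_linear: "g j \<in> linear_forms {1..m}" for j
    unfolding g_def
    by (intro mpoly.subspace_sum mpoly.subspace_scale subspace_linear_forms var_in_linear_forms)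
  have fg: "subst f (g j) = y j" if "j \<in> {1..n}" for j
    using bspec[OF y_eq that] by (simp add: g_def f_def subst_sum subst_mult)
  have f_poly: "f r \<in> carrier (poly_ring n)" if "r \<in> {1..m}" for r
    using y_linear[OF t_mem[OF that]] linear_forms_poly_ring by (auto simp: f_def)
  have g_poly: "g j \<in> carrier (poly_ring m)" for j using g_linear linear_forms_poly_ring by blast
  have yf: "subst y (f r) = f r" if "r \<in> {1..m}" for r
    using subst_y_y[OF t_mem[OF that]] by (simp add: f_def)
  \<comment> \<open>Linear independence of the forms \<open>y (t r)\<close> makes \<open>f\<close>
    injective on linear forms.\<close>
  have f_inj: "q = 0" if "q \<in> linear_forms {1..m}" "subst f q = 0" for q
  proof -
    define d where "d r = lookup q (Poly_Mapping.single r 1)" for r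
    have q: "q = (\<Sum>r\<in>{1..m}. const (d r) * var r)"
      unfolding d_def by (rule linear_form_expansion) (use that in auto)
    have "subst f q = (\<Sum>r\<in>{1..m}. const (d r) * y (t r))"
      by (subst q) (simp add: subst_sum subst_mult f_def)
    then have "d r = 0" if "r \<in> {1..m}" for r using indep[rule_format, of d r] that \<open>subst f q = 0\<close> by simp
    then show "q = 0" using q by simp
  qed
  have gf: "subst g (f r) = var r" if r: "r \<in> {1..m}" for r
  proof -
    have "subst g (f r) \<in> mpoly.span (g ` {1..n})"
      unfolding f_def by (intro subst_linear_form y_linear t_mem r)
    moreover have "mpoly.span (g ` {1..n}) \<subseteq> linear_forms {1..m}"
      using g_linear by (intro mpoly.span_minimal subspace_linear_forms) blast
    ultimately have "subst g (f r) - var r \<in> linear_forms {1..m}"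
      using r by (intro mpoly.subspace_diff subspace_linear_forms var_in_linear_forms) blast+
    \<comment> \<open>Applying \<open>f\<close> after \<open>g\<close> amounts to \<open>y\<close>,
      which fixes \<open>f r\<close>; so \<open>subst g (f r)\<close> and \<open>var r\<close> have
      the same image under \<open>f\<close>.\<close>
    moreover have "subst f (subst g (f r)) = subst y (f r)"
      unfolding subst_subst by (rule subst_cong[OF f_poly[OF r]]) (rule fg)
    then have "subst f (subst g (f r) - var r) = 0" using yf[OF r] by (simp add: subst_diff)
    ultimately show ?thesis using f_inj by fastforce
  qed
  define \<Delta>' where "\<Delta>' = {Q. Q \<subseteq> {1..m} \<and> (\<exists>F\<in>\<Delta>. {1..n} - F \<in> invariant_sets \<and> t ` Q \<subseteq> F)}"
  have complex': "simplicial_complex m \<Delta>'"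
    unfolding simplicial_complex_def
  proof (intro conjI ballI allI impI)
    have "{} \<in> \<Delta>" using complex unfolding simplicial_complex_def by blast
    then obtain F where "F \<in> \<Delta>" "{1..n} - F \<in> invariant_sets" using ex_stable_face by metis
    then have "{} \<in> \<Delta>'" by (auto simp: \<Delta>'_def)
    then show "\<Delta>' \<noteq> {}" by blast
    show "\<Delta>' \<subseteq> Pow {1..m}" by (auto simp: \<Delta>'_def)
    show "Q' \<in> \<Delta>'" if "Q \<in> \<Delta>'" "Q' \<subseteq> Q" for Q Q'
      using that unfolding \<Delta>'_def by blast
    fix r assume r: "r \<in> {1..m}"
    \<comment> \<open>Each \<open>r\<close> is a vertex: a basis form is nonzero, so some variable
      \<open>j\<close> occurs in it, and a stable face containing \<open>nonvanishing {j}\<close>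
      contains \<open>t r\<close>.\<close>
    have "f r \<noteq> 0"
    proof
      assume "f r = 0"
      then have "(\<Sum>l\<in>{1..m}. const (if l = r then 1 else 0) * y (t l)) = 0"
        by (intro sum.neutral) (auto simp: f_def)
      then show False using indep[rule_format, of "\<lambda>l. if l = r then 1 else 0" r] r by simp
    qed
    then obtain a where a: "a \<in> keys (y (t r))" by (fastforce simp: f_def simp flip: keys_eq_empty)
    then obtain j where j: "j \<in> {1..n}" "a = Poly_Mapping.single j 1"
      using linear_formsE[OF y_linear[OF t_mem[OF r]] a] by blast
    have "{j} \<in> \<Delta>" using complex j(1) unfolding simplicial_complex_def by blast
    then obtain F where F: "F \<in> \<Delta>" "nonvanishing {j} \<subseteq> F" "{1..n} - F \<in> invariant_sets"
      by (rule ex_stable_face)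
    have "t r \<in> nonvanishing {j}" using a j t_mem[OF r] by (auto simp: nonvanishing_def)
    then show "{r} \<in> \<Delta>'" using F r by (auto simp: \<Delta>'_def)
  qed
  have fI: "subst f p \<in> SR_ideal n \<Delta>" if "p \<in> SR_ideal m \<Delta>'" for p
    using complex' _ that
  proof (rule subst_SR_ideal)
    fix a :: "nat \<Rightarrow>\<^sub>0 nat" assume a: "keys a \<subseteq> {1..m}" "keys a \<notin> \<Delta>'"
    have "keys b \<subseteq> {1..n} \<and> keys b \<notin> \<Delta>" if b: "b \<in> keys (mono_subst f a)" for b
    proof (intro conjI notI)
      show "keys b \<subseteq> {1..n}"
        using mono_subst_poly_ring[OF a(1) f_poly] b by (simp add: carrier_poly_ring)
      assume "keys b \<in> \<Delta>"
      then obtain F where F: "F \<in> \<Delta>" "nonvanishing (keys b) \<subseteq> F" "{1..n} - F \<in> invariant_sets"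
        by (rule ex_stable_face)
      \<comment> \<open>For each \<open>r\<close> in the support of \<open>a\<close>, the monomial
        \<open>b\<close> contains a variable occurring in \<open>y (t r)\<close>. So
        \<open>t r\<close> lies in \<open>nonvanishing (keys b)\<close>, and the stable face
        \<open>F\<close> shows that \<open>keys a\<close> is a face.\<close>
      have "t r \<in> F" if r: "r \<in> keys a" for r
      proof -
        have tr: "t r \<in> {1..n}" using a(1) r t_mem by blast
        obtain b' where b': "b' \<in> keys (y (t r))" "keys b' \<subseteq> keys b"
          using keys_mono_subst[OF b r] by (auto simp: f_def)
        moreover obtain l where "b' = Poly_Mapping.single l 1"
          using linear_formsE[OF y_linear[OF tr] b'(1)] by blast
        ultimately have "t r \<in> nonvanishing (keys b)" using tr by (auto simp: nonvanishing_def)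
        then show ?thesis using F(2) by blast
      qed
      then have "keys a \<in> \<Delta>'" using a(1) F unfolding \<Delta>'_def by blast
      then show False using a(2) by blast
    qed
    then show "mono_subst f a \<in> SR_ideal n \<Delta>" by (simp add: SR_ideal_eq[OF complex])
  qed
  have gI: "subst g p \<in> SR_ideal m \<Delta>'" if "p \<in> SR_ideal n \<Delta>" for p
    using complex _ that
  proof (rule subst_SR_ideal)
    fix a :: "nat \<Rightarrow>\<^sub>0 nat" assume a: "keys a \<subseteq> {1..n}" "keys a \<notin> \<Delta>"
    have "keys b \<subseteq> {1..m} \<and> keys b \<notin> \<Delta>'" if b: "b \<in> keys (mono_subst g a)" for b
    proof (intro conjI notI)
      show "keys b \<subseteq> {1..m}"
        using mono_subst_poly_ring[OF a(1) g_poly] b by (simp add: carrier_poly_ring)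
      assume "keys b \<in> \<Delta>'"
      then obtain F where F: "F \<in> \<Delta>" "{1..n} - F \<in> invariant_sets" "t ` keys b \<subseteq> F"
        by (auto simp: \<Delta>'_def)
      \<comment> \<open>The support of \<open>a\<close> is not contained in the face
        \<open>F\<close>. An index \<open>j\<close> outside \<open>F\<close> leads to a
        contradiction: \<open>g j\<close> only involves variables \<open>r\<close> with
        \<open>t r\<close> outside \<open>F\<close>, yet one of them occurs in
        \<open>b\<close>.\<close>
      obtain j where j: "j \<in> keys a" "j \<notin> F"
        using a(2) simplicial_complex_mono[OF complex F(1)] by blast
      obtain b' where b': "b' \<in> keys (g j)" "keys b' \<subseteq> keys b"
        using keys_mono_subst[OF b j(1)] by blast
      have "b' \<in> (\<Union>r\<in>{1..m}. keys (const (c j r) * var r))"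
        using b'(1) unfolding g_def by (rule subsetD[OF keys_sum_subset])
      then obtain r where r: "r \<in> {1..m}" "b' \<in> keys (const (c j r) * var r)" by blast
      then have "c j r \<noteq> 0" by auto
      have "b' \<in> keys (var r :: 'k mpolynomial)" by (rule subsetD[OF keys_const_mult r(2)])
      then have "r \<in> keys b" using b'(2) by (simp add: var_def)
      then have "t r \<notin> {1..n} - F" using F(3) by blast
      moreover have "j \<in> {1..n} - F" using j a(1) by blast
      ultimately have "c j r = 0" using adapted[rule_format, OF F(2) _ r(1)] by simp
      then show False using \<open>c j r \<noteq> 0\<close> by blast
    qed
    then show "mono_subst g a \<in> SR_ideal m \<Delta>'" by (simp add: SR_ideal_eq[OF complex'])
  qed
  show ?thesis
    by (intro exI[of _ m] exI[of _ \<Delta>'] exI[of _ f] exI[of _ g] conjI ballI)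
      (rule complex' g_poly | erule f_poly fI gI fg gf yf)+
qed

end

section \<open>From graded retracts to idempotent endomorphisms and back\<close>

lemma algebra_hom_comp:
  "f \<in> algebra_hom K A B \<Longrightarrow> g \<in> algebra_hom K B C \<Longrightarrow> g \<circ> f \<in> algebra_hom K A C"
  unfolding algebra_hom_def ring_hom_def by (auto simp: Pi_iff)

theorem theorem5p1:
  fixes n :: nat and \<Delta> :: "nat set set"
    and R :: "('k::field, 'r) module" and G :: "int \<Rightarrow> 'r set"
  assumes "simplicial_complex n \<Delta>"
    and "noetherian_ring R" and "\<one>\<^bsub>R\<^esub> \<noteq> \<zero>\<^bsub>R\<^esub>"
    and "graded_algebra_retract cring_class_ops (SR_ring n \<Delta>) (SR_grading n \<Delta>) R G"
  shows "\<exists>m \<Delta>'. simplicial_complex m \<Delta>' \<and>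
           algebra_isomorphic cring_class_ops R (SR_ring m \<Delta>' :: ('k, 'k mpolynomial set) module)"
proof -
  let ?K = "cring_class_ops :: 'k ring" and ?B = "SR_ring n \<Delta> :: ('k, 'k mpolynomial set) module"
  obtain \<theta> \<phi> where \<theta>: "\<theta> \<in> algebra_hom ?K R ?B" "\<forall>i. \<theta> ` G i \<subseteq> SR_grading n \<Delta> i"
    and \<phi>: "\<phi> \<in> algebra_hom ?K ?B R" "\<forall>i. \<phi> ` SR_grading n \<Delta> i \<subseteq> G i"
    and retract: "\<forall>x\<in>carrier R. \<phi> (\<theta> x) = x"
    using assms(4) unfolding graded_algebra_retract_def by (elim conjE exE) (rule that)
  define e where "e = \<theta> \<circ> \<phi>"
  have e: "e \<in> algebra_hom ?K ?B ?B" unfolding e_def using \<phi>(1) \<theta>(1) by (rule algebra_hom_comp)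
  have \<theta>_mem: "\<theta> x \<in> carrier ?B" if "x \<in> carrier R" for x
    using \<theta>(1) that by (auto simp: algebra_hom_def ring_hom_def)
  have \<phi>_mem: "\<phi> Y \<in> carrier R" if "Y \<in> carrier ?B" for Y
    using \<phi>(1) that by (auto simp: algebra_hom_def ring_hom_def)
  have e_e: "e (e Y) = e Y" if "Y \<in> carrier ?B" for Y
    using retract \<phi>_mem[OF that] by (simp add: e_def)
  \<comment> \<open>Both maps preserve degree, so the image of a variable under \<open>e\<close> is
    represented by a linear form.\<close>
  have "\<exists>p. p \<in> linear_forms {1..n} \<and> e (SR_class n \<Delta> (var j)) = SR_class n \<Delta> p" if "j \<in> {1..n}" for j
  proof -
    have "SR_class n \<Delta> (var j) \<in> SR_grading n \<Delta> 1"
      unfolding SR_grading_def using that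
      by (intro imageI CollectI conjI poly_ring_var homogeneous_var)
    then have "\<phi> (SR_class n \<Delta> (var j)) \<in> G 1"
      by (rule subsetD[OF \<phi>(2)[rule_format] imageI])
    then have "e (SR_class n \<Delta> (var j)) \<in> SR_grading n \<Delta> 1"
      unfolding e_def comp_def by (rule subsetD[OF \<theta>(2)[rule_format] imageI])
    then obtain p where "p \<in> carrier (poly_ring n)" "homogeneous 1 p"
        "e (SR_class n \<Delta> (var j)) = SR_class n \<Delta> p"
      by (auto simp: SR_grading_def)
    then show ?thesis by (intro exI[of _ p] conjI homogeneous_1_linear_forms)
  qed
  then obtain y where y: "\<And>j. j \<in> {1..n} \<Longrightarrow> y j \<in> linear_forms {1..n}"
    "\<And>j. j \<in> {1..n} \<Longrightarrow> e (SR_class n \<Delta> (var j)) = SR_class n \<Delta> (y j)"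
    by metis
  have y_poly: "y j \<in> carrier (poly_ring n)" if "j \<in> {1..n}" for j
    using y(1)[OF that] linear_forms_poly_ring by blast
  have e_class: "e (SR_class n \<Delta> p) = SR_class n \<Delta> (subst y p)" if "p \<in> carrier (poly_ring n)" for p
    using e y_poly y(2) that by (rule SR_hom_eq_subst)
  interpret linear_idempotent n \<Delta> y
  proof
    fix p :: "'k mpolynomial" assume p: "p \<in> SR_ideal n \<Delta>"
    then have pc: "p \<in> carrier (poly_ring n)"
      by (auto simp: SR_ideal_eq[OF assms(1)] carrier_poly_ring)
    then have "SR_class n \<Delta> p = SR_class n \<Delta> 0" using p by (simp add: SR_class_eq_iff)
    then have "SR_class n \<Delta> (subst y p) = SR_class n \<Delta> (subst y 0)"
      using e_class[OF pc] e_class[of 0] by simp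
    then show "subst y p \<in> SR_ideal n \<Delta>"
      using poly_ring_subst[OF pc y_poly] by (simp add: SR_class_eq_iff)
  next
    fix j assume j: "j \<in> {1..n}"
    have sy: "subst y (y j) \<in> carrier (poly_ring n)" using poly_ring_subst[OF y_poly[OF j] y_poly] .
    have "SR_class n \<Delta> (subst y (y j)) = SR_class n \<Delta> (y j)"
      using e_e[of "SR_class n \<Delta> (var j)"] e_class[OF y_poly[OF j]] y(2)[OF j] j by simp
    then have I: "subst y (y j) - y j \<in> SR_ideal n \<Delta>"
      using sy y_poly[OF j] by (simp add: SR_class_eq_iff)
    \<comment> \<open>Every vertex is a face, so a linear form in the ideal is zero. Once the
      difference is known to be linear, idempotence modulo the ideal becomes an identity of
      polynomials.\<close>
    have "subst y (y j) \<in> mpoly.span (y ` {1..n})" using y(1)[OF j] by (rule subst_linear_form)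
    moreover have "mpoly.span (y ` {1..n}) \<subseteq> linear_forms {1..n}"
      using y(1) by (intro mpoly.span_minimal subspace_linear_forms) blast
    ultimately have L: "subst y (y j) - y j \<in> linear_forms {1..n}"
      using y(1)[OF j] by (intro mpoly.subspace_diff subspace_linear_forms) blast+
    have "keys (subst y (y j) - y j) = {}"
    proof (rule ccontr)
      assume "keys (subst y (y j) - y j) \<noteq> {}"
      then obtain a where a: "a \<in> keys (subst y (y j) - y j)" by blast
      obtain l where l: "l \<in> {1..n}" "a = Poly_Mapping.single l 1" using L a by (rule linear_formsE)
      have "keys a \<notin> \<Delta>" using I a by (simp add: SR_ideal_eq[OF assms(1)])
      then show False using l assms(1) unfolding simplicial_complex_def by auto
    qed
    then show "subst y (y j) = y j" by simp
  qed (use assms(1) y in auto)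
  from image_is_SR obtain m \<Delta>' f g where complex': "simplicial_complex m \<Delta>'"
    and f: "\<forall>r\<in>{1..m}. f r \<in> carrier (poly_ring n)"
    and g: "\<forall>j\<in>{1..n}. g j \<in> carrier (poly_ring m)"
    and fI: "\<forall>p\<in>SR_ideal m \<Delta>'. subst f p \<in> SR_ideal n \<Delta>"
    and gI: "\<forall>p\<in>SR_ideal n \<Delta>. subst g p \<in> SR_ideal m \<Delta>'"
    and fg: "\<forall>j\<in>{1..n}. subst f (g j) = y j"
    and gf: "\<forall>r\<in>{1..m}. subst g (f r) = var r"
    and yf: "\<forall>r\<in>{1..m}. subst y (f r) = f r"
    by (elim exE conjE) (rule that)
  note f = bspec[OF f] and g = bspec[OF g] and fI = bspec[OF fI] and gI = bspec[OF gI]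
    and fg = bspec[OF fg] and gf = bspec[OF gf] and yf = bspec[OF yf]
  let ?C = "SR_ring m \<Delta>' :: ('k, 'k mpolynomial set) module"
  define \<Lambda> where "\<Lambda> = SR_subst n \<Delta> m \<Delta>' g"
  define \<Psi> where "\<Psi> = SR_subst m \<Delta>' n \<Delta> f"
  have \<Lambda>: "\<Lambda> \<in> algebra_hom ?K ?B ?C" unfolding \<Lambda>_def using g gI by (rule SR_subst_hom)
  have \<Lambda>_class: "\<Lambda> (SR_class n \<Delta> p) = SR_class m \<Delta>' (subst g p)" if "p \<in> carrier (poly_ring n)" for p
    unfolding \<Lambda>_def using that g gI by (rule SR_subst_class)
  have \<Psi>_class: "\<Psi> (SR_class m \<Delta>' p) = SR_class n \<Delta> (subst f p)" if "p \<in> carrier (poly_ring m)" for p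
    unfolding \<Psi>_def using that f fI by (rule SR_subst_class)
  have \<Psi>\<Lambda>: "\<Psi> (\<Lambda> Y) = e Y" if "Y \<in> carrier ?B" for Y
  proof -
    from that obtain p where p: "Y = SR_class n \<Delta> p" "p \<in> carrier (poly_ring n)"
      unfolding carrier_SR_ring by (rule imageE)
    have "subst f (subst g p) = subst y p"
      unfolding subst_subst by (rule subst_cong[OF p(2)]) (rule fg)
    then show ?thesis using p poly_ring_subst[OF p(2) g] by (simp add: \<Lambda>_class \<Psi>_class e_class)
  qed
  have \<Lambda>e\<Psi>: "\<Lambda> (e (\<Psi> Z)) = Z" and \<Psi>_mem: "\<Psi> Z \<in> carrier ?B" if "Z \<in> carrier ?C" for Z
  proof -
    from that obtain q where q: "Z = SR_class m \<Delta>' q" "q \<in> carrier (poly_ring m)"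
      unfolding carrier_SR_ring by (rule imageE)
    have fq: "subst f q \<in> carrier (poly_ring n)" using q(2) f by (rule poly_ring_subst)
    have "subst y (subst f q) = subst f q"
      unfolding subst_subst by (rule subst_cong[OF q(2)]) (rule yf)
    moreover have "subst g (subst f q) = subst var q"
      unfolding subst_subst by (rule subst_cong[OF q(2)]) (rule gf)
    ultimately show "\<Lambda> (e (\<Psi> Z)) = Z" "\<Psi> Z \<in> carrier ?B"
      using q fq by (simp_all add: \<Psi>_class e_class \<Lambda>_class subst_var_id)
  qed
  have hom: "\<Lambda> \<circ> \<theta> \<in> algebra_hom ?K R ?C" using \<theta>(1) \<Lambda> by (rule algebra_hom_comp)
  have "bij_betw (\<Lambda> \<circ> \<theta>) (carrier R) (carrier ?C)"
  \<comment> \<open>The inverse is \<open>\<phi> \<circ> \<Psi>\<close>: one composite reduces to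
    \<open>\<phi> \<circ> e \<circ> \<theta>\<close>, which is the identity because
    \<open>\<phi>\<close> retracts \<open>\<theta>\<close>; the other is
    \<open>\<Lambda> \<circ> e \<circ> \<Psi>\<close>, where \<open>e\<close> fixes the image of
    \<open>\<Psi>\<close>.\<close>
  proof (rule bij_betw_byWitness[where f' = "\<phi> \<circ> \<Psi>"])
    show "\<forall>x\<in>carrier R. (\<phi> \<circ> \<Psi>) ((\<Lambda> \<circ> \<theta>) x) = x"
      using \<Psi>\<Lambda> \<theta>_mem retract by (simp add: e_def)
    show "\<forall>Z\<in>carrier ?C. (\<Lambda> \<circ> \<theta>) ((\<phi> \<circ> \<Psi>) Z) = Z"
      using \<Lambda>e\<Psi> by (simp add: e_def)
    show "(\<Lambda> \<circ> \<theta>) ` carrier R \<subseteq> carrier ?C"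
      using hom by (auto simp: algebra_hom_def ring_hom_def)
    show "(\<phi> \<circ> \<Psi>) ` carrier ?C \<subseteq> carrier R"
      using \<Psi>_mem \<phi>_mem by auto
  qed
  then show ?thesis using complex' hom unfolding algebra_isomorphic_def by blast
qed

end
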